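(* Let $P$ be a finitely generated symmetric operad over a field of characteristic zero which is symmetric regular with a finite Gröbner basis. Then its exponential generating series $E_P(z)=\sum_{n\ge1}\frac{\dim P(n)}{n!}z^n$ is an algebraic function, i.e. there is a nonzero polynomial $Q(z,y)\in\mathbb{Q}[z,y]$ with $Q(z,E_P(z))=0$.
   Context: The ground field $\Bbbk$ has characteristic zero. Let $\Upsilon=\bigsqcup_{n\ge1}\Upsilon_n$ be a finite set of operations ($\Upsilon_n$ the $n$-ary ones). A shuffle monomial of arity $n$ is a planar rooted tree with $n$ leaves, each vertex having at least one input, each vertex with $k$ inputs labeled by an element of $\Upsilon_k$, and the leaves labeled bijectively by $1,\dots,n$ such that at every vertex the minimal leaf labels reachable through its inputs increase from left to right. Shuffle monomials form a basis of the free shuffle operad $\mathcal F(\Upsilon)$; shuffle compositions are graftings with any relabeling of leaves that keeps the relative order of the leaves of the grafted tree and of the leaves of the lower tree (the grafted tree being represented by its minimal leaf) and yields a shuffle monomial. A connected subtree $u$ of $v$ becomes a shuffle tree by assigning to each input of $u$ the minimum of the leaves of $v$ reached through it; $v$ is divisible by $w$ if some such $u$ is isomorphic to $w$ as a labeled tree by an isomorphism preserving the order of the leaves. A symmetric operad $P$ is considered as a shuffle operad (forgetting the symmetric group actions) and presented as $\mathcal F(\Upsilon)/C$, where $\Upsilon$ is a linear basis of the generating symmetric collection. An admissible order is a total well-order on the shuffle monomials of each arity compatible with shuffle compositions; a Gröbner basis of $C$ is a subset $G\subset C$ such that the leading (largest) monomial of every nonzero element of $C$ is divisible by the leading monomial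 of some element of $G$; it is reduced if leading coefficients are $1$ and no monomial occurring in an element of $G$ is divisible by the leading monomial of another element of $G$. The tree skeleton of a shuffle monomial is the non-planar vertex-labeled rooted tree obtained by erasing the leaf labels and forgetting the planar structure. A set $M$ of shuffle monomials is symmetric regular if with each $m\in M$ it contains all shuffle monomials with the same tree skeleton. $P$ is symmetric regular with a finite Gröbner basis if, for a finite $\Upsilon$ and some admissible order, its ideal of relations has a finite reduced Gröbner basis whose set of leading monomials is symmetric regular. All components $P(n)$ are finite-dimensional, so that $E_P$ is defined. *)

theory Defs
  imports
    "HOL-Library.Multiset"
    "HOL-Library.Poly_Mapping"
    "HOL-Combinatorics.Permutations"
    "HOL-Computational_Algebra.Polynomial_FPS"
begin

section \<open>Symmetric collections and symmetric operads\<close>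

text \<open>The components of a collection are subspaces of one ambient vector space; they may overlap, so
  every structure map takes the arities as arguments. Only the arities \<open>n \<ge> 1\<close> are meaningful.\<close>

record ('k, 'a) symmetric_collection =
  component :: "nat \<Rightarrow> 'a set"
  scal :: "'k \<Rightarrow> 'a \<Rightarrow> 'a"
  act :: "nat \<Rightarrow> 'a \<Rightarrow> (nat \<Rightarrow> nat) \<Rightarrow> 'a"

locale symmetric_collection =
  fixes X :: "('k::field, 'a::ab_group_add, 'e) symmetric_collection_scheme"
  assumes vector_space: "vector_space (scal X)"
    and subspace: "n \<ge> 1 \<Longrightarrow> module.subspace (scal X) (component X n)"
    and act_closed: "\<lbrakk>n \<ge> 1; a \<in> component X n; \<sigma> permutes {1..n}\<rbrakk> \<Longrightarrow> act X n a \<sigma> \<in> component X n"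
    and act_add: "\<lbrakk>n \<ge> 1; a \<in> component X n; b \<in> component X n; \<sigma> permutes {1..n}\<rbrakk>
      \<Longrightarrow> act X n (a + b) \<sigma> = act X n a \<sigma> + act X n b \<sigma>"
    and act_scal: "\<lbrakk>n \<ge> 1; a \<in> component X n; \<sigma> permutes {1..n}\<rbrakk>
      \<Longrightarrow> act X n (scal X c a) \<sigma> = scal X c (act X n a \<sigma>)"
    and act_id: "\<lbrakk>n \<ge> 1; a \<in> component X n\<rbrakk> \<Longrightarrow> act X n a id = a"
    and act_act: "\<lbrakk>n \<ge> 1; a \<in> component X n; \<sigma> permutes {1..n}; \<tau> permutes {1..n}\<rbrakk>
      \<Longrightarrow> act X n (act X n a \<sigma>) \<tau> = act X n a (\<sigma> \<circ> \<tau>)"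

definition symmetric_collection_hom ::
  "('k::field, 'a::ab_group_add, 'e) symmetric_collection_scheme
    \<Rightarrow> ('k, 'b::ab_group_add, 'f) symmetric_collection_scheme \<Rightarrow> (nat \<Rightarrow> 'a \<Rightarrow> 'b) \<Rightarrow> bool" where
  "symmetric_collection_hom X Y \<phi> \<longleftrightarrow> (\<forall>n\<ge>1. \<forall>a\<in>component X n.
      \<phi> n a \<in> component Y n \<and>
      (\<forall>b\<in>component X n. \<phi> n (a + b) = \<phi> n a + \<phi> n b) \<and>
      (\<forall>c. \<phi> n (scal X c a) = scal Y c (\<phi> n a)) \<and>
      (\<forall>\<sigma>. \<sigma> permutes {1..n} \<longrightarrow> \<phi> n (act X n a \<sigma>) = act Y n (\<phi> n a) \<sigma>))"

text \<open>The right action is normalised so that the \<open>p\<close>-th input of \<open>a \<cdot> \<sigma>\<close> is fed into the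
  \<open>\<sigma> p\<close>-th input of \<open>a\<close>. Accordingly \<open>perm_comp m i n \<sigma> \<tau>\<close> sends the \<open>p\<close>-th input of
  \<open>(a \<cdot> \<sigma>) \<circ>\<^sub>i (b \<cdot> \<tau>)\<close> to the input of \<open>a \<circ>\<^bsub>\<sigma> i\<^esub> b\<close> into which it is fed, for \<open>a\<close> of arity \<open>m\<close>
  and \<open>b\<close> of arity \<open>n\<close>.\<close>

definition perm_comp :: "nat \<Rightarrow> nat \<Rightarrow> nat \<Rightarrow> (nat \<Rightarrow> nat) \<Rightarrow> (nat \<Rightarrow> nat) \<Rightarrow> nat \<Rightarrow> nat" where
  "perm_comp m i n \<sigma> \<tau> p =
    (if p = 0 \<or> p > m + n - 1 then p
     else if i \<le> p \<and> p \<le> i + n - 1 then \<sigma> i + \<tau> (p - i + 1) - 1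
     else let j = (if p < i then p else p - n + 1)
          in if \<sigma> j < \<sigma> i then \<sigma> j else \<sigma> j + n - 1)"

text \<open>\<open>circ P m i n a b\<close> is the partial composition \<open>a \<circ>\<^sub>i b\<close> of \<open>a\<close> of arity \<open>m\<close> and \<open>b\<close> of
  arity \<open>n\<close>.\<close>

record ('k, 'a) symmetric_operad = "('k, 'a) symmetric_collection" +
  circ :: "nat \<Rightarrow> nat \<Rightarrow> nat \<Rightarrow> 'a \<Rightarrow> 'a \<Rightarrow> 'a"
  unit :: 'a

locale symmetric_operad = symmetric_collection P
  for P :: "('k::field, 'a::ab_group_add, 'e) symmetric_operad_scheme" +
  assumes unit_closed: "unit P \<in> component P 1"
    and circ_closed: "\<lbrakk>1 \<le> i; i \<le> m; n \<ge> 1; a \<in> component P m; b \<in> component P n\<rbrakk>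
      \<Longrightarrow> circ P m i n a b \<in> component P (m + n - 1)"
    and circ_add_left: "\<lbrakk>1 \<le> i; i \<le> m; n \<ge> 1; a \<in> component P m; a' \<in> component P m; b \<in> component P n\<rbrakk>
      \<Longrightarrow> circ P m i n (a + a') b = circ P m i n a b + circ P m i n a' b"
    and circ_add_right: "\<lbrakk>1 \<le> i; i \<le> m; n \<ge> 1; a \<in> component P m; b \<in> component P n; b' \<in> component P n\<rbrakk>
      \<Longrightarrow> circ P m i n a (b + b') = circ P m i n a b + circ P m i n a b'"
    and circ_scal_left: "\<lbrakk>1 \<le> i; i \<le> m; n \<ge> 1; a \<in> component P m; b \<in> component P n\<rbrakk>
      \<Longrightarrow> circ P m i n (scal P e a) b = scal P e (circ P m i n a b)"
    and circ_scal_right: "\<lbrakk>1 \<le> i; i \<le> m; n \<ge> 1; a \<in> component P m; b \<in> component P n\<rbrakk>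
      \<Longrightarrow> circ P m i n a (scal P e b) = scal P e (circ P m i n a b)"
    and circ_unit_left: "\<lbrakk>n \<ge> 1; b \<in> component P n\<rbrakk> \<Longrightarrow> circ P 1 1 n (unit P) b = b"
    and circ_unit_right: "\<lbrakk>1 \<le> i; i \<le> m; a \<in> component P m\<rbrakk> \<Longrightarrow> circ P m i 1 a (unit P) = a"
    and circ_sequential: "\<lbrakk>1 \<le> i; i \<le> l; 1 \<le> j; j \<le> m; n \<ge> 1;
        a \<in> component P l; b \<in> component P m; c \<in> component P n\<rbrakk>
      \<Longrightarrow> circ P (l + m - 1) (i + j - 1) n (circ P l i m a b) c
        = circ P l i (m + n - 1) a (circ P m j n b c)"
    and circ_parallel: "\<lbrakk>1 \<le> i; i < k; k \<le> l; m \<ge> 1; n \<ge> 1;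
        a \<in> component P l; b \<in> component P m; c \<in> component P n\<rbrakk>
      \<Longrightarrow> circ P (l + m - 1) (k + m - 1) n (circ P l i m a b) c
        = circ P (l + n - 1) i m (circ P l k n a c) b"
    and circ_equivariant: "\<lbrakk>1 \<le> i; i \<le> m; n \<ge> 1; a \<in> component P m; b \<in> component P n;
        \<sigma> permutes {1..m}; \<tau> permutes {1..n}\<rbrakk>
      \<Longrightarrow> circ P m i n (act P m a \<sigma>) (act P n b \<tau>)
        = act P (m + n - 1) (circ P m (\<sigma> i) n a b) (perm_comp m i n \<sigma> \<tau>)"

section \<open>Shuffle monomials\<close>

text \<open>The label sets \<open>\<Upsilon> k\<close> for different \<open>k\<close> need not be disjoint as sets: the number of inputs of
  a vertex is part of the tree, which makes the union of the \<open>\<Upsilon> k\<close> a disjoint one.\<close>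

datatype 'x ptree = Leaf nat | Node 'x "'x ptree list"

primrec leaves :: "'x ptree \<Rightarrow> nat list" where
  "leaves (Leaf a) = [a]"
| "leaves (Node x ts) = concat (map leaves ts)"

definition min_leaf :: "'x ptree \<Rightarrow> nat" where
  "min_leaf t = Min (set (leaves t))"

fun shuffle_tree :: "(nat \<Rightarrow> 'x set) \<Rightarrow> 'x ptree \<Rightarrow> bool" where
  "shuffle_tree \<Upsilon> (Leaf a) \<longleftrightarrow> True"
| "shuffle_tree \<Upsilon> (Node x ts) \<longleftrightarrow> ts \<noteq> [] \<and> x \<in> \<Upsilon> (length ts) \<and>
     sorted_wrt (<) (map min_leaf ts) \<and> (\<forall>t\<in>set ts. shuffle_tree \<Upsilon> t)"

definition shuffle_monomials :: "(nat \<Rightarrow> 'x set) \<Rightarrow> nat \<Rightarrow> 'x ptree set" where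
  "shuffle_monomials \<Upsilon> n = {t. shuffle_tree \<Upsilon> t \<and> distinct (leaves t) \<and> set (leaves t) = {1..n}}"

definition corolla :: "nat \<Rightarrow> 'x \<Rightarrow> 'x ptree" where
  "corolla n x = Node x (map Leaf [1..<n+1])"

primrec subst :: "(nat \<Rightarrow> 'x ptree) \<Rightarrow> 'x ptree \<Rightarrow> 'x ptree" where
  "subst f (Leaf a) = f a"
| "subst f (Node x ts) = Node x (map (subst f) ts)"

definition relabel :: "(nat \<Rightarrow> nat) \<Rightarrow> 'x ptree \<Rightarrow> 'x ptree" where
  "relabel f = subst (\<lambda>a. Leaf (f a))"

section \<open>Shuffle operads\<close>

text \<open>A shuffle composition of elements of arities \<open>m\<close> and \<open>n\<close> is determined by the set \<open>B\<close> of the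
  labels which the \<open>n\<close> leaves of the upper element receive; the remaining leaves of the lower
  element, together with the grafted one (represented by \<open>Min B\<close>), receive the labels
  \<open>lower_labels m n B\<close>. Both relabelings are increasing, hence the upper element is grafted into
  the leaf \<open>Min B\<close> of the lower one: all labels below \<open>Min B\<close> belong to the lower element.\<close>

definition shuffle_index :: "nat \<Rightarrow> nat \<Rightarrow> nat set \<Rightarrow> bool" where
  "shuffle_index m n B \<longleftrightarrow> B \<subseteq> {1..m+n-1} \<and> card B = n"

definition lower_labels :: "nat \<Rightarrow> nat \<Rightarrow> nat set \<Rightarrow> nat set" where
  "lower_labels m n B = insert (Min B) ({1..m+n-1} - B)"

text \<open>The \<open>j\<close>-th smallest element of a set, and the position of an element, counted from \<open>1\<close>.\<close>

definition nth_elem :: "nat set \<Rightarrow> nat \<Rightarrow> nat" where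
  "nth_elem A j = sorted_list_of_set A ! (j - 1)"

definition rank :: "nat set \<Rightarrow> nat \<Rightarrow> nat" where
  "rank A p = card {q\<in>A. q \<le> p}"

record ('k, 'a) shuffle_operad =
  sh_component :: "nat \<Rightarrow> 'a set"
  sh_scal :: "'k \<Rightarrow> 'a \<Rightarrow> 'a"
  sh_circ :: "nat \<Rightarrow> nat \<Rightarrow> nat set \<Rightarrow> 'a \<Rightarrow> 'a \<Rightarrow> 'a"
  sh_unit :: 'a

definition shuffle_operad_hom ::
  "('k::field, 'a::ab_group_add) shuffle_operad \<Rightarrow> ('k, 'b::ab_group_add) shuffle_operad
    \<Rightarrow> (nat \<Rightarrow> 'a \<Rightarrow> 'b) \<Rightarrow> bool" where
  "shuffle_operad_hom F Q \<pi> \<longleftrightarrow>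
    (\<forall>n\<ge>1. \<forall>f\<in>sh_component F n. \<pi> n f \<in> sh_component Q n \<and>
      (\<forall>g\<in>sh_component F n. \<pi> n (f + g) = \<pi> n f + \<pi> n g) \<and>
      (\<forall>c. \<pi> n (sh_scal F c f) = sh_scal Q c (\<pi> n f))) \<and>
    \<pi> 1 (sh_unit F) = sh_unit Q \<and>
    (\<forall>m\<ge>1. \<forall>n\<ge>1. \<forall>B. \<forall>f\<in>sh_component F m. \<forall>g\<in>sh_component F n. shuffle_index m n B \<longrightarrow>
      \<pi> (m + n - 1) (sh_circ F m n B f g) = sh_circ Q m n B (\<pi> m f) (\<pi> n g))"

definition kernel :: "('k, 'a) shuffle_operad \<Rightarrow> (nat \<Rightarrow> 'a \<Rightarrow> 'b::zero) \<Rightarrow> nat \<Rightarrow> 'a set" where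
  "kernel F \<pi> n = {f \<in> sh_component F n. \<pi> n f = 0}"

subsection \<open>The free shuffle operad\<close>

definition shuffle_graft :: "nat \<Rightarrow> nat \<Rightarrow> nat set \<Rightarrow> 'x ptree \<Rightarrow> 'x ptree \<Rightarrow> 'x ptree" where
  "shuffle_graft m n B s t =
    subst (\<lambda>j. if j = Min B then relabel (nth_elem B) t else Leaf (nth_elem (lower_labels m n B) j)) s"

definition free_shuffle_operad ::
  "(nat \<Rightarrow> 'x set) \<Rightarrow> ('k::field, 'x ptree \<Rightarrow>\<^sub>0 'k) shuffle_operad" where
  "free_shuffle_operad \<Upsilon> = \<lparr>
    sh_component = (\<lambda>n. {f. Poly_Mapping.keys f \<subseteq> shuffle_monomials \<Upsilon> n}),
    sh_scal = (\<lambda>c. Poly_Mapping.map ((*) c)),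
    sh_circ = (\<lambda>m n B f g. \<Sum>s\<in>Poly_Mapping.keys f. \<Sum>t\<in>Poly_Mapping.keys g.
      Poly_Mapping.single (shuffle_graft m n B s t) (Poly_Mapping.lookup f s * Poly_Mapping.lookup g t)),
    sh_unit = Poly_Mapping.single (Leaf 1) 1\<rparr>"

subsection \<open>The shuffle operad of a symmetric operad\<close>

text \<open>The input labelled \<open>p\<close> of the shuffle composition is the input number \<open>shuffle_perm m n B p\<close>
  of the underlying partial composition at \<open>Min B\<close>.\<close>

definition shuffle_perm :: "nat \<Rightarrow> nat \<Rightarrow> nat set \<Rightarrow> nat \<Rightarrow> nat" where
  "shuffle_perm m n B p =
    (if p = 0 \<or> p > m + n - 1 then p
     else if p \<in> B then Min B + rank B p - 1
     else let r = rank (lower_labels m n B) p in if r < Min B then r else r + n - 1)"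

definition forget :: "('k, 'a, 'e) symmetric_operad_scheme \<Rightarrow> ('k, 'a) shuffle_operad" where
  "forget P = \<lparr>
    sh_component = component P,
    sh_scal = scal P,
    sh_circ = (\<lambda>m n B a b. act P (m + n - 1) (circ P m (Min B) n a b) (shuffle_perm m n B)),
    sh_unit = unit P\<rparr>"

text \<open>\<open>X\<close> is the generating symmetric collection (it need not embed into \<open>P\<close>), and the shuffle
  operad of \<open>P\<close> is identified, via \<open>\<pi>\<close>, with the quotient of the free shuffle operad by the kernel
  of \<open>\<pi>\<close>.\<close>

definition shuffle_presentation ::
  "('k::field, 'a::ab_group_add) symmetric_operad \<Rightarrow> ('k, 'x::ab_group_add) symmetric_collection
    \<Rightarrow> (nat \<Rightarrow> 'x set) \<Rightarrow> (nat \<Rightarrow> ('x ptree \<Rightarrow>\<^sub>0 'k) \<Rightarrow> 'a) \<Rightarrow> bool" where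
  "shuffle_presentation P X \<Upsilon> \<pi> \<longleftrightarrow>
    symmetric_collection X \<and>
    (\<forall>n\<ge>1. \<not> module.dependent (scal X) (\<Upsilon> n) \<and> module.span (scal X) (\<Upsilon> n) = component X n) \<and>
    shuffle_operad_hom (free_shuffle_operad \<Upsilon>) (forget P) \<pi> \<and>
    (\<exists>\<phi>. symmetric_collection_hom X P \<phi> \<and>
      (\<forall>n\<ge>1. \<forall>x\<in>\<Upsilon> n. \<pi> n (Poly_Mapping.single (corolla n x) 1) = \<phi> n x)) \<and>
    (\<forall>n\<ge>1. \<pi> n ` sh_component (free_shuffle_operad \<Upsilon>) n = component P n)"

section \<open>Divisibility and Groebner bases\<close>

text \<open>\<open>prune u v\<close>: the tree \<open>u\<close> arises from \<open>v\<close> by cutting off branches, i.e. \<open>u\<close> is a connected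
  subtree containing the root, each of its inputs being labelled by the minimal leaf above it.\<close>

inductive prune :: "'x ptree \<Rightarrow> 'x ptree \<Rightarrow> bool" where
  cut: "prune (Leaf (min_leaf v)) v"
| node: "list_all2 prune us vs \<Longrightarrow> prune (Node x us) (Node x vs)"
monos list_all2_mono

inductive branch :: "'x ptree \<Rightarrow> 'x ptree \<Rightarrow> bool" where
  here: "branch v v"
| above: "\<lbrakk>branch u v; v \<in> set vs\<rbrakk> \<Longrightarrow> branch u (Node x vs)"

definition connected_subtree :: "'x ptree \<Rightarrow> 'x ptree \<Rightarrow> bool" where
  "connected_subtree u v \<longleftrightarrow> (\<exists>s. branch s v \<and> prune u s)"

text \<open>The planar structure of a shuffle tree is determined by the order of its leaves, so an
  isomorphism preserving this order is an increasing relabeling of the leaves.\<close>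

definition divides :: "'x ptree \<Rightarrow> 'x ptree \<Rightarrow> bool" where
  "divides w v \<longleftrightarrow> (\<exists>u f. connected_subtree u v \<and> strict_mono_on (set (leaves u)) f \<and> w = relabel f u)"

text \<open>\<open>r n\<close> is the (reflexive) order on the shuffle monomials of arity \<open>n\<close>.\<close>

definition admissible_order :: "(nat \<Rightarrow> 'x set) \<Rightarrow> (nat \<Rightarrow> ('x ptree \<times> 'x ptree) set) \<Rightarrow> bool" where
  "admissible_order \<Upsilon> r \<longleftrightarrow>
    (\<forall>n\<ge>1. well_order_on (shuffle_monomials \<Upsilon> n) (r n)) \<and>
    (\<forall>m\<ge>1. \<forall>n\<ge>1. \<forall>B s s' t. shuffle_index m n B \<and> t \<in> shuffle_monomials \<Upsilon> n \<and> (s, s') \<in> r m - Id \<longrightarrow>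
      (shuffle_graft m n B s t, shuffle_graft m n B s' t) \<in> r (m + n - 1) - Id) \<and>
    (\<forall>m\<ge>1. \<forall>n\<ge>1. \<forall>B s t t'. shuffle_index m n B \<and> s \<in> shuffle_monomials \<Upsilon> m \<and> (t, t') \<in> r n - Id \<longrightarrow>
      (shuffle_graft m n B s t, shuffle_graft m n B s t') \<in> r (m + n - 1) - Id)"

definition leading_monomial :: "('x ptree \<times> 'x ptree) set \<Rightarrow> ('x ptree \<Rightarrow>\<^sub>0 'k::zero) \<Rightarrow> 'x ptree" where
  "leading_monomial R f = (THE t. t \<in> Poly_Mapping.keys f \<and> (\<forall>s\<in>Poly_Mapping.keys f. (s, t) \<in> R))"

definition groebner_basis ::
  "(nat \<Rightarrow> ('x ptree \<times> 'x ptree) set) \<Rightarrow> (nat \<Rightarrow> ('x ptree \<Rightarrow>\<^sub>0 'k::zero) set)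
    \<Rightarrow> (nat \<Rightarrow> ('x ptree \<Rightarrow>\<^sub>0 'k) set) \<Rightarrow> bool" where
  "groebner_basis r C G \<longleftrightarrow>
    (\<forall>n\<ge>1. G n \<subseteq> C n) \<and>
    (\<forall>n\<ge>1. \<forall>f\<in>C n. f \<noteq> 0 \<longrightarrow> (\<exists>k\<ge>1. \<exists>g\<in>G k. g \<noteq> 0 \<and>
      divides (leading_monomial (r k) g) (leading_monomial (r n) f)))"

definition reduced ::
  "(nat \<Rightarrow> ('x ptree \<times> 'x ptree) set) \<Rightarrow> (nat \<Rightarrow> ('x ptree \<Rightarrow>\<^sub>0 'k::field) set) \<Rightarrow> bool" where
  "reduced r G \<longleftrightarrow> (\<forall>n\<ge>1. \<forall>g\<in>G n.
    Poly_Mapping.lookup g (leading_monomial (r n) g) = 1 \<and>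
    (\<forall>t\<in>Poly_Mapping.keys g. \<forall>k\<ge>1. \<forall>h\<in>G k. h \<noteq> g \<longrightarrow> \<not> divides (leading_monomial (r k) h) t))"

definition leading_monomials ::
  "(nat \<Rightarrow> ('x ptree \<times> 'x ptree) set) \<Rightarrow> (nat \<Rightarrow> ('x ptree \<Rightarrow>\<^sub>0 'k::zero) set) \<Rightarrow> 'x ptree set" where
  "leading_monomials r G = (\<Union>n\<in>{1..}. leading_monomial (r n) ` G n)"

section \<open>Symmetric regularity\<close>

datatype 'x skeleton = SLeaf | SNode 'x "'x skeleton multiset"

primrec tree_skeleton :: "'x ptree \<Rightarrow> 'x skeleton" where
  "tree_skeleton (Leaf a) = SLeaf"
| "tree_skeleton (Node x ts) = SNode x (mset (map tree_skeleton ts))"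

definition symmetric_regular :: "(nat \<Rightarrow> 'x set) \<Rightarrow> 'x ptree set \<Rightarrow> bool" where
  "symmetric_regular \<Upsilon> M \<longleftrightarrow>
    (\<forall>m\<in>M. \<forall>n. \<forall>t\<in>shuffle_monomials \<Upsilon> n. tree_skeleton t = tree_skeleton m \<longrightarrow> t \<in> M)"

definition symmetric_regular_finite_groebner ::
  "('k::field, 'a::ab_group_add) symmetric_operad \<Rightarrow> (nat \<Rightarrow> 'x::ab_group_add set) \<Rightarrow> bool" where
  "symmetric_regular_finite_groebner P \<Upsilon> \<longleftrightarrow>
    finite (SIGMA n:{1..}. \<Upsilon> n) \<and>
    (\<exists>X \<pi> r G. shuffle_presentation P X \<Upsilon> \<pi> \<and>
      admissible_order \<Upsilon> r \<and>
      groebner_basis r (kernel (free_shuffle_operad \<Upsilon>) \<pi>) G \<and>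
      reduced r G \<and>
      finite (\<Union>n\<in>{1..}. G n) \<and>
      symmetric_regular \<Upsilon> (leading_monomials r G))"

section \<open>The exponential generating series\<close>

definition exp_gen_series :: "('k::field, 'a::ab_group_add) symmetric_operad \<Rightarrow> rat fps" where
  "exp_gen_series P =
    Abs_fps (\<lambda>n. if n = 0 then 0 else of_nat (vector_space.dim (scal P) (component P n)) / fact n)"

end

(* By the Groebner basis property, dim P(n) is the number of shuffle monomials of arity n not divisible
   by a leading monomial. By symmetric regularity, divisibility depends only on the tree skeleton, and
   a finite tree automaton, whose states record which parts of the leading skeletons occur at the root,
   recognises the normal trees. The k! orderings of the children of a vertex are indistinguishable for
   the automaton, so the exponential generating series of its states satisfy a finite system of
   polynomial equations. Finite-dimensionality of the components excludes cycles of unary transitions,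
   which makes the Jacobian of the system invertible; hence a derivation over Q(z) kills the solution,
   whereas a transcendental series would admit a derivation with value 1. *)

theory Submission
  imports Defs
    "HOL-Computational_Algebra.Formal_Laurent_Series"
    "HOL-Combinatorics.Multiset_Permutations"
begin

section \<open>Derivations of subrings and algebraicity\<close>

text \<open>A derivation is kept as a map on a subring of a field: adjoining an element
  \<open>w\<close> then just means passing to the polynomial expressions in \<open>w\<close>, so no
  fraction field and no derivation of the whole field has to be built. Characteristic zero enters
  here: the derivative of a minimal relation of an algebraic \<open>w\<close> is nonzero, so the
  value at \<open>w\<close> can be solved for. Laurent series supply the ambient field. The sum of
  all unknowns is adjoined first, with derivative 1 if it is transcendental; the single unknowns
  follow with whatever values are possible. Instead of a determinant, orders of vanishing give the
  contradiction: differentiating a product of two or more series without constant term raises the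
  lowest order by at least one, so the lowest terms of the derivatives could only come from unary
  rules, and these are well-founded. On the operadic side, subtrees of a monomial do not carry the
  labels \<open>1..k\<close>. Trees with arbitrary distinct labels are therefore used throughout and
  are standardized only when a statement about the ideal is made.\<close>

locale subring_derivation =
  fixes A :: "'a::field_char_0 set" and D :: "'a \<Rightarrow> 'a"
  assumes one_mem: "1 \<in> A"
    and add_mem: "x \<in> A \<Longrightarrow> y \<in> A \<Longrightarrow> x + y \<in> A"
    and uminus_mem: "x \<in> A \<Longrightarrow> - x \<in> A"
    and mult_mem: "x \<in> A \<Longrightarrow> y \<in> A \<Longrightarrow> x * y \<in> A"
    and D_add: "x \<in> A \<Longrightarrow> y \<in> A \<Longrightarrow> D (x + y) = D x + D y"
    and D_mult: "x \<in> A \<Longrightarrow> y \<in> A \<Longrightarrow> D (x * y) = x * D y + y * D x"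
begin

lemma zero_mem: "0 \<in> A"
  using add_mem[OF one_mem uminus_mem[OF one_mem]] by simp

lemma D_zero: "D 0 = 0"
  using D_add[OF zero_mem zero_mem] by simp

lemma D_one: "D 1 = 0"
  using D_mult[OF one_mem one_mem] by simp

lemma sum_mem: "(\<And>i. i \<in> I \<Longrightarrow> f i \<in> A) \<Longrightarrow> sum f I \<in> A"
  by (induction I rule: infinite_finite_induct) (auto simp: zero_mem add_mem)

lemma D_sum: "(\<And>i. i \<in> I \<Longrightarrow> f i \<in> A) \<Longrightarrow> D (sum f I) = (\<Sum>i\<in>I. D (f i))"
  by (induction I rule: infinite_finite_induct) (auto simp: D_zero D_add sum_mem)

lemma prod_list_mem: "set xs \<subseteq> A \<Longrightarrow> prod_list xs \<in> A"
  by (induction xs) (auto simp: one_mem mult_mem)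

definition polys :: "'a poly set" where
  "polys = {p. \<forall>i. coeff p i \<in> A}"

lemma polys_add: "p \<in> polys \<Longrightarrow> q \<in> polys \<Longrightarrow> p + q \<in> polys"
  and polys_uminus: "p \<in> polys \<Longrightarrow> - p \<in> polys"
  and polys_mult: "p \<in> polys \<Longrightarrow> q \<in> polys \<Longrightarrow> p * q \<in> polys"
  and polys_monom: "c \<in> A \<Longrightarrow> monom c n \<in> polys"
  by (auto simp: polys_def add_mem uminus_mem coeff_mult zero_mem intro!: sum_mem mult_mem)

lemma polys_const: "c \<in> A \<Longrightarrow> [:c:] \<in> polys"
  using polys_monom[of c 0] by (simp add: monom_0)

lemma polys_X: "[:0, 1:] \<in> polys"
  using polys_monom[OF one_mem, of 1] by (simp add: monom_altdef)

lemma map_poly_D_add: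
  "p \<in> polys \<Longrightarrow> q \<in> polys \<Longrightarrow> map_poly D (p + q) = map_poly D p + map_poly D q"
  by (rule poly_eqI) (simp add: coeff_map_poly D_zero polys_def D_add)

lemma map_poly_D_mult:
  "p \<in> polys \<Longrightarrow> q \<in> polys \<Longrightarrow> map_poly D (p * q) = p * map_poly D q + map_poly D p * q"
  by (rule poly_eqI)
    (simp add: coeff_map_poly D_zero polys_def coeff_mult D_sum mult_mem D_mult sum.distrib mult.commute[of "D (coeff p i)" for i])

text \<open>For a root \<open>w\<close> of \<open>p\<close> this has to vanish if \<open>D\<close> extends to \<open>w\<close> with the value \<open>d\<close>.\<close>

definition lift :: "'a \<Rightarrow> 'a \<Rightarrow> 'a poly \<Rightarrow> 'a" where
  "lift w d p = poly (map_poly D p) w + poly (pderiv p) w * d"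

lemma lift_add: "p \<in> polys \<Longrightarrow> q \<in> polys \<Longrightarrow> lift w d (p + q) = lift w d p + lift w d q"
  by (simp add: lift_def map_poly_D_add pderiv_add algebra_simps)

lemma lift_mult:
  "p \<in> polys \<Longrightarrow> q \<in> polys \<Longrightarrow> lift w d (p * q) = poly p w * lift w d q + poly q w * lift w d p"
  by (simp add: lift_def map_poly_D_mult pderiv_mult algebra_simps)

lemma lift_uminus: "p \<in> polys \<Longrightarrow> lift w d (- p) = - lift w d p"
  using lift_add[OF _ polys_uminus, of p p w d]
  by (simp add: eq_neg_iff_add_eq_0 add.commute) (simp add: lift_def)

lemma lift_const: "lift w d [:c:] = D c"
  by (simp add: lift_def map_poly_pCons D_zero)

lemma lift_X: "lift w d [:0, 1:] = d"
  by (simp add: lift_def map_poly_pCons D_zero D_one pderiv_pCons)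

definition transcendental :: "'a \<Rightarrow> bool" where
  "transcendental w \<longleftrightarrow> (\<forall>p\<in>polys. poly p w = 0 \<longrightarrow> p = 0)"

text \<open>A relation \<mu> of least degree dictates the value: differentiating
  \<open>poly \<mu> w = 0\<close> leaves a linear equation for \<open>d\<close>. Every other
  relation is reduced to \<mu> by pseudo-division, so the same \<open>d\<close> fits all of
  them.\<close>

lemma lift_compatible_algebraic:
  assumes "\<not> transcendental w"
  shows "\<exists>d. \<forall>p\<in>polys. poly p w = 0 \<longrightarrow> lift w d p = 0"
proof -
  let ?R = "\<lambda>p. p \<in> polys \<and> poly p w = 0 \<and> p \<noteq> 0"
  obtain \<mu> where mu: "?R \<mu>" and min: "\<And>p. ?R p \<Longrightarrow> degree \<mu> \<le> degree p"
    using assms ex_has_least_nat[of ?R _ degree] unfolding transcendental_def by metis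
  have deg: "degree \<mu> \<noteq> 0"
    using mu by (metis degree_eq_zeroE mult_zero_right poly_pCons poly_0 add.right_neutral pCons_0_0)
  have "pderiv \<mu> \<in> polys"
  proof -
    have "of_nat n * x \<in> A" if "x \<in> A" for n x
      using that by (induction n) (auto simp: zero_mem add_mem distrib_right)
    then show ?thesis using mu by (auto simp: polys_def coeff_pderiv simp del: of_nat_Suc)
  qed
  moreover have "pderiv \<mu> \<noteq> 0" and "degree (pderiv \<mu>) < degree \<mu>"
    using deg by (auto simp: pderiv_eq_0_iff degree_pderiv)
  \<comment> \<open>Were \<open>w\<close> a root of the derivative, this would be a nonzero relation
    of smaller degree.\<close>
  ultimately have sep: "poly (pderiv \<mu>) w \<noteq> 0"
    using min[of "pderiv \<mu>"] by linarith
  define d where "d = - poly (map_poly D \<mu>) w / poly (pderiv \<mu>) w"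
  have lift_mu: "lift w d \<mu> = 0"
    using sep by (simp add: lift_def d_def)
  have "lift w d p = 0" if "p \<in> polys" "poly p w = 0" for p
    using that
  proof (induction "degree p" arbitrary: p rule: less_induct)
    case less
    show ?case
    proof (cases "p = 0")
      case True
      then show ?thesis by (simp add: lift_def)
    next
      case False
      then have le: "degree \<mu> \<le> degree p" using min less.prems by blast
      \<comment> \<open>Pseudo-division: \<open>A\<close> need not contain inverses, so
        \<open>p\<close> is multiplied by the leading coefficient of \<mu> before its top term is
        cancelled. That coefficient is nonzero, hence \<open>lift w d p\<close> vanishes once
        \<open>lift w d ?q\<close> does.\<close>
      let ?a = "lead_coeff \<mu>" and ?m = "monom (lead_coeff p) (degree p - degree \<mu>)"
      let ?q = "[:?a:] * p + - (?m * \<mu>)"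
      have mem: "[:?a:] \<in> polys" "?m \<in> polys" "\<mu> \<in> polys"
        using mu less.prems polys_const[of ?a] polys_monom[of "lead_coeff p"] by (simp_all add: polys_def)
      have q: "?q \<in> polys" "poly ?q w = 0"
        by (intro polys_add polys_mult polys_uminus mem less.prems) (use less.prems mu in simp)
      have "degree ?q < degree p"
      proof (rule degree_lessI)
        show "?q \<noteq> 0 \<or> 0 < degree p" using le deg by simp
        have "degree ?q \<le> degree p"
        proof (rule degree_add_le)
          show "degree ([:?a:] * p) \<le> degree p" by simp
          show "degree (- (?m * \<mu>)) \<le> degree p"
            using degree_mult_le[of ?m \<mu>] degree_monom_le[of "lead_coeff p" "degree p - degree \<mu>"] le
            by simp
        qed
        have "coeff ?q (degree p) = 0"
          using le by (simp add: coeff_monom_mult)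
        have "coeff ?q k = 0" if "k \<ge> degree p" for k
        proof (cases "k = degree p")
          case False
          then show ?thesis using that \<open>degree ?q \<le> degree p\<close> by (intro coeff_eq_0) linarith
        qed (use \<open>coeff ?q (degree p) = 0\<close> in blast)
        then show "\<forall>k\<ge>degree p. coeff ?q k = 0" by blast
      qed
      then have "lift w d ?q = 0" using less.hyps q by blast
      moreover have "lift w d ?q = ?a * lift w d p"
      proof -
        have "lift w d ?q = lift w d ([:?a:] * p) + - lift w d (?m * \<mu>)"
          by (simp only: lift_add[OF polys_mult polys_uminus[OF polys_mult]]
              lift_uminus[OF polys_mult] mem less.prems)
        also have "\<dots> = ?a * lift w d p"
          unfolding lift_mult[OF mem(1) less.prems(1)] lift_mult[OF mem(2,3)] lift_mu
          using mu less.prems by simp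
        finally show ?thesis .
      qed
      ultimately show ?thesis using mu by simp
    qed
  qed
  then show ?thesis by blast
qed

text \<open>\<open>D'\<close> sends \<open>poly p w\<close> to \<open>lift w d p\<close>. This is
  independent of \<open>p\<close> because \<open>lift w d\<close> kills all relations of
  \<open>w\<close>; a transcendental \<open>w\<close> has only the trivial one, so
  \<open>d = 1\<close> is possible.\<close>

lemma extend:
  obtains A' D' where "subring_derivation A' D'" "A \<subseteq> A'" "w \<in> A'" "\<And>x. x \<in> A \<Longrightarrow> D' x = D x"
    "transcendental w \<Longrightarrow> D' w = 1"
proof -
  have "\<exists>d. (\<forall>p\<in>polys. poly p w = 0 \<longrightarrow> lift w d p = 0) \<and> (transcendental w \<longrightarrow> d = 1)"
  proof (cases "transcendental w")
    case True
    then have "\<forall>p\<in>polys. poly p w = 0 \<longrightarrow> lift w 1 p = 0"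
      by (auto simp: transcendental_def lift_def)
    then show ?thesis by blast
  qed (use lift_compatible_algebraic in blast)
  then obtain d where d: "\<And>p. p \<in> polys \<Longrightarrow> poly p w = 0 \<Longrightarrow> lift w d p = 0"
    and d1: "transcendental w \<Longrightarrow> d = 1" by blast
  define A' where "A' = (\<lambda>p. poly p w) ` polys"
  define D' where "D' x = lift w d (SOME p. p \<in> polys \<and> poly p w = x)" for x
  have D': "D' (poly p w) = lift w d p" if p: "p \<in> polys" for p
  proof -
    define q where "q = (SOME q. q \<in> polys \<and> poly q w = poly p w)"
    have q: "q \<in> polys \<and> poly q w = poly p w"
      unfolding q_def by (rule someI[of _ p]) (use p in simp)
    have "lift w d (p + - q) = 0"
      by (rule d) (use p q in \<open>auto intro!: polys_add polys_uminus simp del: add_uminus_conv_diff\<close>)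
    then have "lift w d p + - lift w d q = 0"
      using p q by (simp add: lift_add[OF p polys_uminus] lift_uminus del: add_uminus_conv_diff)
    then show ?thesis by (simp add: D'_def q_def)
  qed
  have mem: "\<exists>p\<in>polys. x = poly p w" if "x \<in> A'" for x using that by (auto simp: A'_def)
  have A'I: "poly p w \<in> A'" if "p \<in> polys" for p using that by (auto simp: A'_def)
  have "subring_derivation A' D'"
  proof
    show "1 \<in> A'" using A'I[OF polys_const[OF one_mem]] by simp
  next
    fix x y assume "x \<in> A'" "y \<in> A'"
    then obtain p q where pq: "p \<in> polys" "x = poly p w" "q \<in> polys" "y = poly q w" using mem by metis
    show "x + y \<in> A'" using A'I[OF polys_add[of p q]] pq by simp
    show "x * y \<in> A'" using A'I[OF polys_mult[of p q]] pq by simp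
    show "D' (x + y) = D' x + D' y"
      using D'[OF polys_add[of p q]] D'[of p] D'[of q] pq by (simp add: lift_add)
    show "D' (x * y) = x * D' y + y * D' x"
      using D'[OF polys_mult[of p q]] D'[of p] D'[of q] pq by (simp add: lift_mult)
  next
    fix x assume "x \<in> A'"
    then obtain p where "p \<in> polys" "x = poly p w" using mem by metis
    then show "- x \<in> A'" using A'I[OF polys_uminus[of p]] by simp
  qed
  moreover have "A \<subseteq> A'" using A'I[OF polys_const] by fastforce
  moreover have "w \<in> A'" using A'I[OF polys_X] by simp
  moreover have "D' x = D x" if "x \<in> A" for x
    using D'[OF polys_const[OF that]] by (simp add: lift_const)
  moreover have "D' w = 1" if "transcendental w"
    using D'[OF polys_X] d1[OF that] by (simp add: lift_X)
  ultimately show thesis by (rule that)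
qed

text \<open>The values on \<open>W\<close> are left open; in the application the equations of the
  system determine them.\<close>

lemma extend_finite:
  assumes "finite W"
  obtains A' D' where "subring_derivation A' D'" "A \<subseteq> A'" "W \<subseteq> A'" "\<And>x. x \<in> A \<Longrightarrow> D' x = D x"
  using assms
proof (induction W arbitrary: thesis rule: finite_induct)
  case empty
  show ?case by (rule empty[of A D]) (use subring_derivation_axioms in auto)
next
  case (insert w W)
  obtain A1 D1 where 1: "subring_derivation A1 D1" "A \<subseteq> A1" "W \<subseteq> A1" "\<And>x. x \<in> A \<Longrightarrow> D1 x = D x"
    using insert.IH by metis
  interpret E: subring_derivation A1 D1 by (rule 1)
  obtain A2 D2 where 2: "subring_derivation A2 D2" "A1 \<subseteq> A2" "w \<in> A2" "\<And>x. x \<in> A1 \<Longrightarrow> D2 x = D1 x"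
    using E.extend[of w] by metis
  show ?case by (rule insert.prems[of A2 D2]) (use 1 2 in auto)
qed

end

section \<open>Orders of vanishing and polynomial systems\<close>

text \<open>The zero series is listed separately, since \<open>fls_subdegree 0\<close> is 0 by
  convention.\<close>

definition vanishes_below :: "int \<Rightarrow> 'a::zero fls \<Rightarrow> bool" where
  "vanishes_below v f \<longleftrightarrow> f = 0 \<or> v \<le> fls_subdegree f"

lemma vanishes_below_iff: "vanishes_below v f \<longleftrightarrow> (\<forall>i<v. fls_nth f i = 0)"
  unfolding vanishes_below_def
  by (metis fls_eq0_below_subdegree fls_zero_nth fls_subdegree_geI order_less_le_trans)

lemma vanishes_below_add:
  "vanishes_below v f \<Longrightarrow> vanishes_below v g \<Longrightarrow> vanishes_below v (f + g :: 'a::comm_monoid_add fls)"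
  by (simp add: vanishes_below_iff)

lemma vanishes_below_mult:
  "vanishes_below v f \<Longrightarrow> vanishes_below w g \<Longrightarrow> vanishes_below (v + w) (f * g :: 'a::field fls)"
  unfolding vanishes_below_def by (auto intro: order_trans[OF _ fls_mult_subdegree_ge])

lemma vanishes_below_prod_list:
  "(\<And>x. x \<in> set xs \<Longrightarrow> vanishes_below 1 x) \<Longrightarrow> vanishes_below (int (length xs)) (prod_list xs :: 'a::field fls)"
proof (induction xs)
  case (Cons x xs)
  then show ?case using vanishes_below_mult[of 1 x "int (length xs)" "prod_list xs"] by simp
qed (simp add: vanishes_below_def)

text \<open>In each term of the Leibniz rule one factor is differentiated, of order at least
  \<open>v\<close>, and the other \<open>length qs - 1\<close> factors have order at least 1. The
  empty list is harmless because its product 1 has derivative 0.\<close>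

lemma derivation_prod_list_vanishes_below:
  fixes E :: "'b \<Rightarrow> 'c::field_char_0 fls"
  assumes "subring_derivation B d"
    and "\<And>q. q \<in> set qs \<Longrightarrow> E q \<in> B \<and> vanishes_below 1 (E q) \<and> vanishes_below v (d (E q))"
  shows "vanishes_below (v + int (length qs) - 1) (d (prod_list (map E qs)))"
  using assms(2)
proof (induction qs)
  case Nil
  then show ?case by (simp add: subring_derivation.D_one[OF assms(1)] vanishes_below_def)
next
  case (Cons q qs)
  interpret B: subring_derivation B d by (rule assms(1))
  have mem: "E q \<in> B" "prod_list (map E qs) \<in> B" using Cons.prems by (auto intro!: B.prod_list_mem)
  have "vanishes_below (1 + (v + int (length qs) - 1)) (E q * d (prod_list (map E qs)))"
    by (rule vanishes_below_mult) (use Cons in auto)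
  moreover have "vanishes_below (int (length qs) + v) (prod_list (map E qs) * d (E q))"
    by (rule vanishes_below_mult) (use Cons.prems vanishes_below_prod_list[of "map E qs"] in auto)
  ultimately show ?case by (simp add: B.D_mult[OF mem] vanishes_below_add algebra_simps)
qed

text \<open>The unary terms are the linear ones; well-foundedness makes the linear part of the system
  unipotent, so that its Jacobian is invertible at the origin and every derivation over the
  polynomials kills the solution.\<close>

theorem algebraic_sum_of_polynomial_system:
  fixes E :: "'q \<Rightarrow> rat fps" and M :: "'q \<Rightarrow> 'm set" and c :: "'m \<Rightarrow> rat" and l :: "'m \<Rightarrow> 'q list"
  assumes fin: "finite I"
    and E0: "\<And>q. q \<in> I \<Longrightarrow> E q $ 0 = 0"
    and M_closed: "\<And>q m. q \<in> I \<Longrightarrow> m \<in> M q \<Longrightarrow> set (l m) \<subseteq> I"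
    and eq: "\<And>q. q \<in> I \<Longrightarrow>
      E q = fps_of_poly (p q) + (\<Sum>m\<in>M q. fps_const (c m) * prod_list (map E (l m)))"
    and wf: "wf {(q', q). q \<in> I \<and> (\<exists>m\<in>M q. l m = [q'])}"
  shows "\<exists>Q :: rat poly poly. Q \<noteq> 0 \<and> poly (map_poly fps_of_poly Q) (\<Sum>q\<in>I. E q) = 0"
proof (rule ccontr)
  assume contra: "\<not> ?thesis"
  let ?\<iota> = "\<lambda>p :: rat poly. fps_to_fls (fps_of_poly p)"
  define A0 where "A0 = range ?\<iota>"
  define S where "S = fps_to_fls (\<Sum>q\<in>I. E q)"
  \<comment> \<open>The start is the zero derivation on the polynomials, embedded into the Laurent
    series.\<close>
  interpret Z: subring_derivation A0 "\<lambda>_. 0"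
  proof
    show "1 \<in> A0" unfolding A0_def by (rule range_eqI[of _ _ 1]) simp
    fix x y assume "x \<in> A0" "y \<in> A0"
    then obtain a b where ab: "x = ?\<iota> a" "y = ?\<iota> b" by (auto simp: A0_def)
    show "x + y \<in> A0" unfolding A0_def ab
      by (rule range_eqI[of _ _ "a + b"]) (simp add: fps_of_poly_add)
    show "x * y \<in> A0" unfolding A0_def ab
      by (rule range_eqI[of _ _ "a * b"]) (simp add: fps_of_poly_mult fls_times_fps_to_fls)
  next
    fix x assume "x \<in> A0"
    then obtain a where "x = ?\<iota> a" by (auto simp: A0_def)
    then show "- x \<in> A0" unfolding A0_def
      by (intro range_eqI[of _ _ "- a"]) (simp add: fps_of_poly_uminus)
  qed auto
  have "Z.transcendental S"
    unfolding Z.transcendental_def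
  proof (intro ballI impI)
    fix g assume g: "g \<in> Z.polys" "poly g S = 0"
    \<comment> \<open>The coefficients of \<open>g\<close> are embedded polynomials; pulled back,
      they give a candidate for \<open>Q\<close>, which \<open>contra\<close> forces to be 0. The
      value \<open>inv 0 = 0\<close> lets \<open>map_poly\<close> act coefficientwise.\<close>
    define inv where "inv = inv_into UNIV ?\<iota>"
    have inv: "?\<iota> (inv x) = x" if "x \<in> A0" for x
      unfolding inv_def by (rule f_inv_into_f) (use that in \<open>simp add: A0_def\<close>)
    have inv0: "inv 0 = 0"
      using inv[OF Z.zero_mem] by (simp add: fps_of_poly_eq_iff[of _ 0, simplified])
    define Q where "Q = map_poly inv g"
    have Q: "map_poly ?\<iota> Q = g"
      by (rule poly_eqI)
        (use g(1) in \<open>simp add: Q_def coeff_map_poly inv0 inv Z.polys_def\<close>)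
    have "poly (map_poly ?\<iota> R) (fps_to_fls x) = fps_to_fls (poly (map_poly fps_of_poly R) x)" for R x
      by (induction R) (simp_all add: map_poly_pCons fls_times_fps_to_fls)
    then have "poly (map_poly fps_of_poly Q) (\<Sum>q\<in>I. E q) = 0"
      using g(2) Q by (metis S_def fps_to_fls_eq_0_iff)
    then have "Q = 0" using contra by blast
    then show "g = 0" using Q by simp
  qed
  then obtain A1 D1 where 1: "subring_derivation A1 D1" "A0 \<subseteq> A1" "S \<in> A1" "\<And>x. x \<in> A0 \<Longrightarrow> D1 x = 0"
    "D1 S = 1" using Z.extend[of S] by metis
  \<comment> \<open>Adjoining the single series makes the derivation applicable to the equations,
    without changing its value 1 at \<open>S\<close>.\<close>
  define F where "F q = fps_to_fls (E q)" for q
  obtain A2 D2 where 2: "subring_derivation A2 D2" "A1 \<subseteq> A2" "F ` I \<subseteq> A2" "\<And>x. x \<in> A1 \<Longrightarrow> D2 x = D1 x"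
    using subring_derivation.extend_finite[OF 1(1), of "F ` I"] fin by (metis finite_imageI)
  interpret D: subring_derivation A2 D2 by (rule 2)
  have const: "D2 x = 0" "x \<in> A2" if "x \<in> A0" for x using that 1 2 by auto
  have S: "S = sum F I"
    unfolding S_def F_def by (induction I rule: infinite_finite_induct) auto
  have F_eq: "F q = ?\<iota> (p q) + (\<Sum>m\<in>M q. fls_const (c m) * prod_list (map F (l m)))" if "q \<in> I" for q
  proof -
    have pl: "fps_to_fls (prod_list (map E qs)) = prod_list (map F qs)" for qs
      by (induction qs) (simp_all add: F_def fls_times_fps_to_fls)
    have "fps_to_fls (sum f J) = (\<Sum>m\<in>J. fps_to_fls (f m))" for f :: "'m \<Rightarrow> rat fps" and J
      by (induction J rule: infinite_finite_induct) auto
    then show ?thesis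
      unfolding F_def[of q] by (subst eq[OF that]) (simp add: fls_times_fps_to_fls pl)
  qed
  have low: "vanishes_below 1 (F q)" if "q \<in> I" for q
    using E0[OF that] by (auto simp: vanishes_below_iff F_def)
  have c0: "fls_const a \<in> A0" for a
    unfolding A0_def by (rule range_eqI[of _ _ "[:a:]"]) (simp add: fps_of_poly_const)
  have p0: "?\<iota> (p q) \<in> A0" for q by (simp add: A0_def)
  have DF: "D2 (F q) = (\<Sum>m\<in>M q. fls_const (c m) * D2 (prod_list (map F (l m))))" if q: "q \<in> I" for q
  proof -
    have mem: "prod_list (map F (l m)) \<in> A2" if "m \<in> M q" for m
      using M_closed[OF q that] 2(3) by (intro D.prod_list_mem) auto
    have "D2 (F q) = (\<Sum>m\<in>M q. D2 (fls_const (c m) * prod_list (map F (l m))))"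
      unfolding F_eq[OF q]
      by (simp add: D.D_add D.D_sum D.sum_mem D.mult_mem const[OF p0] mem const(2)[OF c0])
    also have "\<dots> = (\<Sum>m\<in>M q. fls_const (c m) * D2 (prod_list (map F (l m))))"
      by (intro sum.cong refl) (simp add: D.D_mult mem const[OF c0])
    finally show ?thesis .
  qed
  have "D2 (F q) = 0" if "q \<in> I" for q
  proof (rule ccontr)
    assume nz: "D2 (F q) \<noteq> 0"
    \<comment> \<open>\<open>v\<close> is the lowest order among the nonzero derivatives;
      \<open>T\<close> will collect the states whose derivative has a nonzero coefficient at that
      order.\<close>
    define V where "V = (\<lambda>q. fls_subdegree (D2 (F q))) ` {q \<in> I. D2 (F q) \<noteq> 0}"
    define v where "v = Min V"
    have V: "finite V" "V \<noteq> {}" using fin nz \<open>q \<in> I\<close> by (auto simp: V_def)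
    then have "v \<in> V" unfolding v_def by (rule Min_in)
    then obtain q1 where q1: "q1 \<in> I" "D2 (F q1) \<noteq> 0" "v = fls_subdegree (D2 (F q1))"
      by (auto simp: V_def)
    have Dlow: "vanishes_below v (D2 (F q))" if "q \<in> I" for q
      using V that by (auto simp: vanishes_below_def v_def V_def intro!: Min_le)
    define T where "T = {q \<in> I. fls_nth (D2 (F q)) v \<noteq> 0}"
    have "q1 \<in> T" using q1 by (simp add: T_def nth_fls_subdegree_nonzero)
    define R where "R = {(q', q). q \<in> I \<and> (\<exists>m\<in>M q. l m = [q'])}"
    have "wf R" using wf by (simp add: R_def)
    \<comment> \<open>By minimality the equation of \<open>q2\<close> has no linear term in a state
      of \<open>T\<close>.\<close>
    then obtain q2 where q2T: "q2 \<in> T" and minT: "\<And>q'. (q', q2) \<in> R \<Longrightarrow> q' \<notin> T"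
      using wfE_min[OF _ \<open>q1 \<in> T\<close>] by metis
    have q2: "q2 \<in> I" "fls_nth (D2 (F q2)) v \<noteq> 0" using q2T by (auto simp: T_def)
    have min: "q' \<notin> T" if "m \<in> M q2" "l m = [q']" for q' m
      using that q2(1) by (intro minT) (auto simp: R_def)
    have "fls_nth (D2 (prod_list (map F (l m)))) v = 0" if m: "m \<in> M q2" for m
    proof -
      have sub: "set (l m) \<subseteq> I" using M_closed[OF q2(1) m] .
      \<comment> \<open>Constants are killed, linear terms have no coefficient at \<open>v\<close>
        by the choice of \<open>q2\<close>, and longer products start at order \<open>v + 1\<close>
        or later.\<close>
      consider "l m = []" | q' where "l m = [q']" | "length (l m) \<ge> 2"
        by (cases "l m"; cases "tl (l m)") auto
      then show ?thesis
      proof cases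
        case 1
        then show ?thesis by (simp add: D.D_one)
      next
        case 2
        then show ?thesis using min[OF m 2] sub by (simp add: T_def)
      next
        case 3
        have "vanishes_below (v + int (length (l m)) - 1) (D2 (prod_list (map F (l m))))"
          by (rule derivation_prod_list_vanishes_below[OF D.subring_derivation_axioms])
            (use sub 2(3) low Dlow in auto)
        then show ?thesis using 3 by (simp add: vanishes_below_iff)
      qed
    qed
    then have "fls_nth (D2 (F q2)) v = 0"
      unfolding DF[OF q2(1)] by (simp add: fls_nth_sum)
    then show False using q2 by simp
  qed
  then have "D2 S = 0" unfolding S using 2(3) by (subst D.D_sum) auto
  then show False using 1 2 by auto
qed

section \<open>Leaves and relabelings of shuffle trees\<close>

lemma leaves_nonempty: "shuffle_tree \<Upsilon> t \<Longrightarrow> leaves t \<noteq> []"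
proof (induction t)
  case (Node x ts)
  then show ?case by (cases ts) auto
qed simp

lemma min_leaf_mem: "leaves t \<noteq> [] \<Longrightarrow> min_leaf t \<in> set (leaves t)"
  by (simp add: min_leaf_def)

lemma leaves_subst: "leaves (subst f t) = concat (map (\<lambda>a. leaves (f a)) (leaves t))"
proof (induction t)
  case (Node x ts)
  have "concat (map (\<lambda>t. concat (map g (leaves t))) ts) = concat (map g (concat (map leaves ts)))" for g :: "nat \<Rightarrow> nat list"
    by (induction ts) auto
  then show ?case using Node by (simp add: o_def cong: map_cong)
qed simp

lemma subst_cong: "(\<And>a. a \<in> set (leaves t) \<Longrightarrow> f a = g a) \<Longrightarrow> subst f t = subst g t"
  by (induction t) auto

lemma subst_subst: "subst f (subst g t) = subst (\<lambda>a. subst f (g a)) t"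
  by (induction t) auto

lemma subst_Leaf [simp]: "subst Leaf t = t"
  by (induction t) (auto simp: map_idI)

lemma relabel_simps [simp]:
  "relabel f (Leaf a) = Leaf (f a)"
  "relabel f (Node x ts) = Node x (map (relabel f) ts)"
  by (simp_all add: relabel_def)

lemma leaves_relabel [simp]: "leaves (relabel f t) = map f (leaves t)"
  by (simp add: relabel_def leaves_subst)

lemma relabel_cong: "(\<And>a. a \<in> set (leaves t) \<Longrightarrow> f a = g a) \<Longrightarrow> relabel f t = relabel g t"
  unfolding relabel_def by (rule subst_cong) simp

lemma relabel_relabel: "relabel f (relabel g t) = relabel (\<lambda>a. f (g a)) t"
  by (simp add: relabel_def subst_subst)

lemma relabel_id: "(\<And>a. a \<in> set (leaves t) \<Longrightarrow> f a = a) \<Longrightarrow> relabel f t = t"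
  using subst_cong[of t "\<lambda>a. Leaf (f a)" Leaf] by (simp add: relabel_def)

lemma tree_skeleton_relabel [simp]: "tree_skeleton (relabel f t) = tree_skeleton t"
  by (induction t) (auto simp: o_def intro!: image_mset_cong)

lemma min_leaf_relabel:
  assumes "strict_mono_on (set (leaves t)) f" "leaves t \<noteq> []"
  shows "min_leaf (relabel f t) = f (min_leaf t)"
  unfolding min_leaf_def
proof (rule Min_eqI)
  fix y assume "y \<in> set (leaves (relabel f t))"
  then obtain a where "a \<in> set (leaves t)" "y = f a" by auto
  then show "f (Min (set (leaves t))) \<le> y"
    using strict_mono_on_leD[OF assms(1), of "Min (set (leaves t))" a] assms(2) by auto
qed (use assms(2) in auto)

text \<open>Increasing relabelings commute with \<open>min_leaf\<close>, so the order of the minima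
  at each vertex is kept.\<close>

lemma shuffle_tree_relabel:
  "shuffle_tree \<Upsilon> t \<Longrightarrow> strict_mono_on (set (leaves t)) f \<Longrightarrow> shuffle_tree \<Upsilon> (relabel f t)"
proof (induction t)
  case (Node x ts)
  have mono: "strict_mono_on (set (leaves t)) f" if "t \<in> set ts" for t
    using Node.prems(2) that by (rule_tac monotone_on_subset[of "set (leaves (Node x ts))"]) auto
  have ne: "leaves t \<noteq> []" if "t \<in> set ts" for t
    using Node.prems(1) that leaves_nonempty by fastforce
  have "sorted_wrt (\<lambda>s t. min_leaf (relabel f s) < min_leaf (relabel f t)) ts"
  proof (rule sorted_wrt_mono_rel)
    show "sorted_wrt (\<lambda>s t. min_leaf s < min_leaf t) ts"
      using Node.prems(1) by (simp add: sorted_wrt_map)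
    fix s t assume st: "s \<in> set ts" "t \<in> set ts" "min_leaf s < min_leaf t"
    then have "f (min_leaf s) < f (min_leaf t)"
      using strict_mono_onD[OF Node.prems(2), of "min_leaf s" "min_leaf t"] min_leaf_mem ne by auto
    then show "min_leaf (relabel f s) < min_leaf (relabel f t)"
      using st min_leaf_relabel[OF mono ne] by simp
  qed
  then show ?case using Node.IH Node.prems(1) mono by (simp add: sorted_wrt_map)
qed simp

subsection \<open>Standardization of leaf labels\<close>

lemma rank_strict_mono: "finite A \<Longrightarrow> strict_mono_on A (rank A)"
proof (rule strict_mono_onI)
  fix r s assume fin: "finite A" and rs: "r \<in> A" "s \<in> A" "r < s"
  have "{q \<in> A. q \<le> r} \<subseteq> {q \<in> A. q \<le> s} - {s}" using rs by auto
  then have "rank A r \<le> card ({q \<in> A. q \<le> s} - {s})"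
    unfolding rank_def by (rule card_mono[rotated]) (use fin in simp)
  also have "\<dots> < rank A s"
    unfolding rank_def by (rule card_Diff1_less) (use fin rs in auto)
  finally show "rank A r < rank A s" .
qed

lemma rank_image: "finite A \<Longrightarrow> rank A ` A = {1..card A}"
proof (rule card_subset_eq)
  assume fin: "finite A"
  show "rank A ` A \<subseteq> {1..card A}"
    using fin by (auto simp: rank_def Suc_le_eq card_gt_0_iff intro!: card_mono)
  show "card (rank A ` A) = card {1..card A}"
    using card_image[OF strict_mono_on_imp_inj_on[OF rank_strict_mono[OF fin]]] by simp
qed simp

lemma rank_strict_mono_image:
  assumes "strict_mono_on A f" "p \<in> A"
  shows "rank (f ` A) (f p) = rank A p"
proof -
  have "{q \<in> f ` A. q \<le> f p} = f ` {q \<in> A. q \<le> p}"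
    using strict_mono_on_less_eq[OF assms(1)] assms(2) by auto
  moreover have "inj_on f {q \<in> A. q \<le> p}"
    using strict_mono_on_imp_inj_on[OF assms(1)] by (rule inj_on_subset) auto
  ultimately show ?thesis by (simp add: rank_def card_image)
qed

lemma rank_atLeastAtMost: "p \<in> {1..n} \<Longrightarrow> rank {1..n} p = p"
proof -
  assume "p \<in> {1..n}"
  then have "{q \<in> {1..n}. q \<le> p} = {1..p}" by auto
  then show ?thesis by (simp add: rank_def)
qed

lemma nth_elem_rank:
  assumes "finite A" "a \<in> A"
  shows "nth_elem A (rank A a) = a"
proof -
  define xs where "xs = sorted_list_of_set A"
  have xs: "set xs = A" "sorted_wrt (<) xs" "distinct xs"
    using assms by (simp_all add: xs_def)
  obtain i where i: "i < length xs" "xs ! i = a"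
    using assms(2) xs(1) unfolding in_set_conv_nth[symmetric] set_conv_nth by auto
  have le: "xs ! j \<le> a \<longleftrightarrow> j \<le> i" if "j < length xs" for j
    using sorted_wrt_nth_less[OF xs(2), of i j] sorted_wrt_nth_less[OF xs(2), of j i] i that
    by (cases i j rule: linorder_cases) auto
  have "{q \<in> A. q \<le> a} = (!) xs ` {..i}"
  proof (intro equalityI subsetI)
    fix q assume "q \<in> {q \<in> A. q \<le> a}"
    then obtain j where "j < length xs" "xs ! j = q" "xs ! j \<le> a"
      unfolding xs(1)[symmetric] set_conv_nth by auto
    then show "q \<in> (!) xs ` {..i}" using le by auto
  next
    fix q assume "q \<in> (!) xs ` {..i}"
    then obtain j where "j \<le> i" "q = xs ! j" by auto
    then show "q \<in> {q \<in> A. q \<le> a}" using le[of j] i(1) nth_mem[of j xs] xs(1) by simp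
  qed
  moreover have "inj_on ((!) xs) {..i}"
    by (rule inj_on_nth) (use xs i in auto)
  ultimately have "rank A a = Suc i" by (simp add: rank_def card_image)
  then show ?thesis using i by (simp add: nth_elem_def xs_def)
qed

lemma nth_elem_strict_mono: "finite A \<Longrightarrow> strict_mono_on {1..card A} (nth_elem A)"
proof (rule strict_mono_onI)
  fix i j assume fin: "finite A" and ij: "i \<in> {1..card A}" "j \<in> {1..card A}" "i < j"
  obtain a b where ab: "a \<in> A" "i = rank A a" "b \<in> A" "j = rank A b"
    using ij(1,2) unfolding rank_image[OF fin, symmetric] by blast
  then have "a < b" using ij(3) strict_mono_on_less[OF rank_strict_mono[OF fin], of a b] by simp
  then show "nth_elem A i < nth_elem A j" using ab nth_elem_rank[OF fin] by simp
qed

lemma nth_elem_image: "finite A \<Longrightarrow> nth_elem A ` {1..card A} = A"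
proof -
  assume fin: "finite A"
  have "nth_elem A ` rank A ` A = A" by (simp add: image_image nth_elem_rank[OF fin])
  then show ?thesis by (simp only: rank_image[OF fin])
qed

lemma rank_nth_elem: "finite A \<Longrightarrow> j \<in> {1..card A} \<Longrightarrow> rank A (nth_elem A j) = j"
proof -
  assume fin: "finite A" and "j \<in> {1..card A}"
  then have "j \<in> rank A ` A" by (simp only: rank_image)
  then show ?thesis using nth_elem_rank[OF fin] by auto
qed

section \<open>Counting shuffle trees accepted by a tree automaton\<close>

text \<open>Subsets are grouped by size; this is the source of the binomial coefficients in products
  of exponential generating series.\<close>

lemma sum_Pow_card:
  fixes g :: "nat \<Rightarrow> 'a::comm_semiring_1"
  assumes "finite A"
  shows "(\<Sum>B\<in>Pow A. g (card B)) = (\<Sum>j\<le>card A. of_nat (card A choose j) * g j)"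
proof -
  have "(\<Sum>j\<le>card A. of_nat (card A choose j) * g j) = (\<Sum>j\<le>card A. \<Sum>B\<in>{B \<in> Pow A. card B = j}. g (card B))"
    using n_subsets[OF assms] by (intro sum.cong refl) simp
  also have "\<dots> = (\<Sum>B\<in>Pow A. g (card B))"
    by (rule sum.group) (use assms card_mono in auto)
  finally show ?thesis by simp
qed

text \<open>\<open>S\<close> splits into classes of rearrangements. As the keys are distinct, each
  class has exactly \<open>n!\<close> members, and just one of them is sorted.\<close>

lemma card_eq_fact_mult_card_sorted:
  fixes key :: "'a \<Rightarrow> 'b::linorder"
  assumes "finite S" and len: "\<And>xs. xs \<in> S \<Longrightarrow> length xs = n"
    and dist: "\<And>xs. xs \<in> S \<Longrightarrow> distinct (map key xs)"
    and perm: "\<And>xs ys. xs \<in> S \<Longrightarrow> mset ys = mset xs \<Longrightarrow> ys \<in> S"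
  shows "card S = fact n * card {xs \<in> S. sorted_wrt (<) (map key xs)}"
proof -
  let ?T = "{xs \<in> S. sorted_wrt (<) (map key xs)}"
  have dist': "distinct xs" "inj_on key (set xs)" if "xs \<in> S" for xs
    using dist[OF that] by (auto simp: distinct_map)
  have "S = (\<Union>xs\<in>?T. permutations_of_set (set xs))"
  proof (intro equalityI subsetI)
    fix ys assume ys: "ys \<in> S"
    let ?xs = "sort_key key ys"
    have "?xs \<in> S" using perm[OF ys] by simp
    moreover have "sorted_wrt (<) (map key ?xs)"
      using dist[OF \<open>?xs \<in> S\<close>] sorted_sort_key[of key ys] by (simp add: strict_sorted_iff)
    moreover have "ys \<in> permutations_of_set (set ?xs)"
      using dist'[OF ys] by (simp add: permutations_of_set_def)
    ultimately show "ys \<in> (\<Union>xs\<in>?T. permutations_of_set (set xs))" by blast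
  next
    fix ys assume "ys \<in> (\<Union>xs\<in>?T. permutations_of_set (set xs))"
    then obtain xs where "xs \<in> S" "set ys = set xs" "distinct ys"
      by (auto simp: permutations_of_set_def)
    then show "ys \<in> S" using perm[of xs ys] dist' set_eq_iff_mset_eq_distinct by metis
  qed
  then have "card S = card (\<Union>xs\<in>?T. permutations_of_set (set xs))" by simp
  also have "\<dots> = (\<Sum>xs\<in>?T. card (permutations_of_set (set xs)))"
  proof (rule card_UN_disjoint)
    show "finite ?T" using assms(1) by simp
    show "\<forall>xs\<in>?T. finite (permutations_of_set (set xs))" by simp
    show "\<forall>xs\<in>?T. \<forall>ys\<in>?T. xs \<noteq> ys \<longrightarrow> permutations_of_set (set xs) \<inter> permutations_of_set (set ys) = {}"
    proof (intro ballI impI, rule ccontr)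
      fix xs ys assume *: "xs \<in> ?T" "ys \<in> ?T" "xs \<noteq> ys"
        "permutations_of_set (set xs) \<inter> permutations_of_set (set ys) \<noteq> {}"
      then have set: "set xs = set ys" by (auto simp: permutations_of_set_def)
      \<comment> \<open>A strictly sorted list of keys is determined by its set, and keys are
        injective on the elements at hand.\<close>
      then have "map key xs = map key ys"
        using * strict_sorted_equal[of "map key xs" "map key ys"] by auto
      moreover have "inj_on key (set xs \<union> set ys)" using set dist' * by auto
      ultimately show False using * map_inj_on by blast
    qed
  qed
  also have "\<dots> = (\<Sum>xs\<in>?T. fact n)"
    using len dist' by (intro sum.cong refl) (auto simp: distinct_card)
  finally show ?thesis by simp
qed

locale tree_automaton =
  fixes \<Upsilon> :: "nat \<Rightarrow> 'x set" and Q :: "'s set" and s0 :: 's and step :: "'x \<Rightarrow> 's list \<Rightarrow> 's"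
    and good :: "'s \<Rightarrow> bool"
  assumes finite_ops: "finite (SIGMA n:{1..}. \<Upsilon> n)"
    and finite_Q: "finite Q"
    and s0_mem: "s0 \<in> Q"
    and step_mem: "step x qs \<in> Q"
    and step_perm: "mset qs = mset qs' \<Longrightarrow> step x qs = step x qs'"
begin

primrec run :: "'x ptree \<Rightarrow> 's" where
  "run (Leaf a) = s0"
| "run (Node x ts) = step x (map run ts)"

text \<open>\<open>good\<close> is demanded at every vertex, so all branches of an accepted tree are
  accepted. Quantifying over \<open>map accepted ts\<close> gives the recursive calls the shape that
  \<open>primrec\<close> expects.\<close>

primrec accepted :: "'x ptree \<Rightarrow> bool" where
  "accepted (Leaf a) \<longleftrightarrow> good s0"
| "accepted (Node x ts) \<longleftrightarrow> good (step x (map run ts)) \<and> (\<forall>b\<in>set (map accepted ts). b)"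

lemma run_mem: "run t \<in> Q"
  by (cases t) (auto simp: s0_mem step_mem)

lemma run_relabel [simp]: "run (relabel f t) = run t"
  by (induction t) (auto simp: o_def cong: map_cong)

lemma accepted_relabel [simp]: "accepted (relabel f t) \<longleftrightarrow> accepted t"
  by (induction t) (auto simp: o_def cong: map_cong)

text \<open>Arbitrary label sets are allowed because the children of a vertex share out its labels;
  \<open>bij_betw_trees\<close> shows that only the size of a finite set matters for
  counting.\<close>

definition trees :: "'s \<Rightarrow> nat set \<Rightarrow> 'x ptree set" where
  "trees q A = {t. shuffle_tree \<Upsilon> t \<and> distinct (leaves t) \<and> set (leaves t) = A \<and> accepted t \<and> run t = q}"

definition forests :: "'s list \<Rightarrow> nat set \<Rightarrow> 'x ptree list set" where
  "forests qs A = {ts. list_all2 (\<lambda>t q. shuffle_tree \<Upsilon> t \<and> accepted t \<and> run t = q) ts qs \<and>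
     distinct (concat (map leaves ts)) \<and> set (concat (map leaves ts)) = A}"

definition egf :: "'s \<Rightarrow> rat fps" where
  "egf q = Abs_fps (\<lambda>n. of_nat (card (trees q {1..n})) / fact n)"

lemma trees_relabel:
  "t \<in> trees q A \<Longrightarrow> strict_mono_on A f \<Longrightarrow> relabel f t \<in> trees q (f ` A)"
  using strict_mono_on_imp_inj_on
  by (auto simp: trees_def distinct_map shuffle_tree_relabel)

lemma bij_betw_trees:
  assumes "finite A"
  shows "bij_betw (relabel (rank A)) (trees q A) (trees q {1..card A})"
proof (rule bij_betw_byWitness[where f' = "relabel (nth_elem A)"])
  show "\<forall>t\<in>trees q A. relabel (nth_elem A) (relabel (rank A) t) = t"
    using assms by (auto simp: relabel_relabel trees_def nth_elem_rank intro!: relabel_id)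
  show "\<forall>t\<in>trees q {1..card A}. relabel (rank A) (relabel (nth_elem A) t) = t"
    using assms by (auto simp: relabel_relabel trees_def rank_nth_elem intro!: relabel_id)
  show "relabel (rank A) ` trees q A \<subseteq> trees q {1..card A}"
    using trees_relabel[OF _ rank_strict_mono[OF assms]] rank_image[OF assms] by auto
  show "relabel (nth_elem A) ` trees q {1..card A} \<subseteq> trees q A"
    using trees_relabel[OF _ nth_elem_strict_mono[OF assms]] nth_elem_image[OF assms] by auto
qed

lemma trees_empty: "trees q {} = {}"
  using leaves_nonempty by (fastforce simp: trees_def)

text \<open>Only states reached by accepted trees: the argument against unary cycles starts from a
  tree in the given state, so other states have to stay out of the system.\<close>

definition states :: "'s set" where
  "states = {q. \<exists>A. trees q A \<noteq> {}}"

lemma finite_states: "finite states"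
  by (rule finite_subset[OF _ finite_Q]) (auto simp: states_def trees_def run_mem)

text \<open>The order of the children is deliberately left free here: dropping the condition on the minimal
  leaves multiplies the count by \<open>k!\<close> and turns it into a sum of products of generating series.\<close>

definition children :: "nat \<Rightarrow> 'x \<Rightarrow> 's \<Rightarrow> nat set \<Rightarrow> 'x ptree list set" where
  "children k x q A = {ts. length ts = k \<and> (\<forall>t\<in>set ts. shuffle_tree \<Upsilon> t \<and> accepted t) \<and>
     distinct (concat (map leaves ts)) \<and> set (concat (map leaves ts)) = A \<and> step x (map run ts) = q}"

definition transitions :: "nat \<Rightarrow> 'x \<Rightarrow> 's \<Rightarrow> 's list set" where
  "transitions k x q = {qs. length qs = k \<and> set qs \<subseteq> states \<and> step x qs = q}"

lemma finite_transitions: "finite (transitions k x q)"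
  by (rule finite_subset[OF _ finite_lists_length_eq[OF finite_states, of k]])
    (auto simp: transitions_def)

lemma run_mem_states:
  "shuffle_tree \<Upsilon> t \<Longrightarrow> accepted t \<Longrightarrow> distinct (leaves t) \<Longrightarrow> run t \<in> states"
  by (auto simp: states_def trees_def)

text \<open>Tuples are classified by their lists of states. These lie in \<open>states\<close>
  because each child is itself an accepted shuffle tree with distinct leaves.\<close>

lemma children_eq_UN_forests: "children k x q A = (\<Union>qs\<in>transitions k x q. forests qs A)"
proof (intro equalityI subsetI)
  fix ts assume ts: "ts \<in> children k x q A"
  then have "distinct (concat (map leaves ts))" by (simp add: children_def)
  then have "distinct (leaves t)" if "t \<in> set ts" for t
    using that by (induction ts) auto
  then have "run t \<in> states" if "t \<in> set ts" for t
    using ts that run_mem_states by (simp add: children_def)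
  then have "map run ts \<in> transitions k x q"
    using ts by (auto simp: children_def transitions_def)
  moreover have "ts \<in> forests (map run ts) A"
    using ts by (simp add: children_def forests_def list_all2_conv_all_nth)
  ultimately show "ts \<in> (\<Union>qs\<in>transitions k x q. forests qs A)" by blast
next
  fix ts assume "ts \<in> (\<Union>qs\<in>transitions k x q. forests qs A)"
  then obtain qs where qs: "qs \<in> transitions k x q" "ts \<in> forests qs A" by blast
  have "map run ts = qs"
    by (rule nth_equalityI) (use qs(2) in \<open>auto simp: forests_def list_all2_conv_all_nth\<close>)
  moreover have "\<forall>t\<in>set ts. shuffle_tree \<Upsilon> t \<and> accepted t"
    using qs(2) by (auto simp: forests_def list_all2_conv_all_nth all_set_conv_all_nth)
  ultimately show "ts \<in> children k x q A"
    using qs by (auto simp: forests_def children_def transitions_def dest: list_all2_lengthD)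
qed

text \<open>The symmetry \<open>step_perm\<close> of the automaton enters here; the remaining
  conditions concern only the multiset of children.\<close>

lemma children_perm:
  assumes "ts \<in> children k x q A" "mset ts' = mset ts"
  shows "ts' \<in> children k x q A"
proof -
  have "mset (map run ts') = mset (map run ts)"
    and "mset (concat (map leaves ts')) = mset (concat (map leaves ts))"
    using assms(2) by (simp_all add: mset_concat flip: sum_mset_sum_list)
  then have "step x (map run ts') = step x (map run ts)"
    and "distinct (concat (map leaves ts')) \<longleftrightarrow> distinct (concat (map leaves ts))"
    and "set (concat (map leaves ts')) = set (concat (map leaves ts))"
    using step_perm mset_eq_imp_distinct_iff mset_eq_setD by metis+
  then show ?thesis
    using assms(1) mset_eq_length[OF assms(2)] mset_eq_setD[OF assms(2)]
    unfolding children_def mem_Collect_eq by (simp only:) blast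
qed

text \<open>Disjoint nonempty leaf sets have different minima. Hence every tuple of children has
  exactly one shuffle order.\<close>

lemma children_distinct:
  assumes "ts \<in> children k x q A"
  shows "distinct (map min_leaf ts)"
proof -
  have "\<forall>t\<in>set ts. leaves t \<noteq> []" using assms leaves_nonempty by (auto simp: children_def)
  moreover have "distinct (concat (map leaves ts))" using assms by (simp add: children_def)
  ultimately show ?thesis
  proof (induction ts)
    case (Cons t ts)
    have "min_leaf t \<noteq> min_leaf u" if "u \<in> set ts" for u
      using Cons.prems that min_leaf_mem[of t] min_leaf_mem[of u] by (auto simp: disjoint_iff)
    then show ?case using Cons by auto
  qed simp
qed

text \<open>The shuffle condition at the root becomes a sorting condition on tuples whose order was
  free, which is the form needed for the division by \<open>k!\<close>.\<close>

lemma trees_eq: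
  "trees q A = (if q = s0 \<and> good q then {Leaf a | a. A = {a}} else {}) \<union>
    (if good q then \<Union>(k, x)\<in>(SIGMA n:{1..}. \<Upsilon> n).
      Node x ` {ts \<in> children k x q A. sorted_wrt (<) (map min_leaf ts)} else {})"
  (is "_ = ?R")
proof (intro equalityI subsetI)
  fix t assume t: "t \<in> trees q A"
  show "t \<in> ?R"
  proof (cases t)
    case (Leaf a)
    then show ?thesis using t by (auto simp: trees_def)
  next
    case (Node x ts)
    have "length ts \<ge> 1" using t Node by (cases ts) (auto simp: trees_def)
    then have "(length ts, x) \<in> (SIGMA n:{1..}. \<Upsilon> n)" "good q"
      "ts \<in> {ts \<in> children (length ts) x q A. sorted_wrt (<) (map min_leaf ts)}"
      using t Node by (auto simp: trees_def children_def)
    then show ?thesis using Node by (auto simp del: SigmaE)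
  qed
next
  fix t assume t: "t \<in> ?R"
  then consider a where "t = Leaf a" "q = s0" "good q" "A = {a}" |
    k x ts where "k \<ge> 1" "x \<in> \<Upsilon> k" "t = Node x ts" "ts \<in> children k x q A"
      "sorted_wrt (<) (map min_leaf ts)" "good q"
    by (auto split: if_splits)
  then show "t \<in> trees q A"
    by cases (auto simp: trees_def children_def)
qed

end

section \<open>Equations for the generating series of the states\<close>

text \<open>Finitely many operations alone do not ensure this, since unary vertices do not change
  the arity. The assumption makes the cardinalities in \<open>egf\<close> genuine and excludes unary
  cycles.\<close>

locale finite_tree_automaton = tree_automaton +
  assumes finite_accepted: "n \<ge> 1 \<Longrightarrow> finite {t \<in> shuffle_monomials \<Upsilon> n. accepted t}"
begin

lemma finite_trees: "finite A \<Longrightarrow> finite (trees q A)"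
proof (cases "A = {}")
  case False
  assume fin: "finite A"
  with False have "card A \<noteq> 0" by simp
  then have "finite {t \<in> shuffle_monomials \<Upsilon> (card A). accepted t}"
    by (intro finite_accepted) simp
  moreover have "trees q {1..card A} \<subseteq> {t \<in> shuffle_monomials \<Upsilon> (card A). accepted t}"
    by (rule subsetI) (simp add: trees_def shuffle_monomials_def)
  ultimately have "finite (trees q {1..card A})" by (rule rev_finite_subset)
  then show ?thesis by (rule iffD2[OF bij_betw_finite[OF bij_betw_trees[OF fin]]])
qed (simp add: trees_empty)

lemma card_trees: "finite A \<Longrightarrow> of_nat (card (trees q A)) = fact (card A) * egf q $ card A"
  by (subst bij_betw_same_card[OF bij_betw_trees], assumption) (simp add: egf_def)

lemma forests_Cons:
  "forests (q # qs) A = (\<Union>B\<in>Pow A. (\<lambda>(t, ts). t # ts) ` (trees q B \<times> forests qs (A - B)))"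
proof (intro equalityI subsetI)
  fix us assume us: "us \<in> forests (q # qs) A"
  then obtain t ts where [simp]: "us = t # ts" by (auto simp: forests_def list_all2_Cons2)
  have "t \<in> trees q (set (leaves t))" "ts \<in> forests qs (A - set (leaves t))" "set (leaves t) \<in> Pow A"
    using us by (auto simp: forests_def trees_def)
  then show "us \<in> (\<Union>B\<in>Pow A. (\<lambda>(t, ts). t # ts) ` (trees q B \<times> forests qs (A - B)))"
    by (intro UN_I[of "set (leaves t)"] image_eqI[of _ _ "(t, ts)"]) auto
next
  fix us assume "us \<in> (\<Union>B\<in>Pow A. (\<lambda>(t, ts). t # ts) ` (trees q B \<times> forests qs (A - B)))"
  then obtain B t ts where "us = t # ts" "B \<subseteq> A" "t \<in> trees q B" "ts \<in> forests qs (A - B)"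
    by auto
  then show "us \<in> forests (q # qs) A" by (auto simp: forests_def trees_def)
qed

text \<open>Sharing out labels among a sequence of trees multiplies exponential generating series.
  Finiteness is carried along because \<open>card\<close> of an infinite set is 0.\<close>

lemma forests_card:
  assumes "finite A"
  shows "finite (forests qs A) \<and>
    of_nat (card (forests qs A)) = fact (card A) * prod_list (map egf qs) $ card A"
  using assms
proof (induction qs arbitrary: A)
  case Nil
  have "forests [] A = (if A = {} then {[]} else {})" by (auto simp: forests_def)
  then show ?case using Nil by auto
next
  case (Cons q qs)
  let ?P = "prod_list (map egf qs)" and ?n = "card A"
  have fin: "finite B" "finite (A - B)" "card (A - B) = ?n - card B" if "B \<in> Pow A" for B
    using that Cons.prems by (auto intro: finite_subset card_Diff_subset)
  let ?F = "\<lambda>B. (\<lambda>(t, ts). t # ts) ` (trees q B \<times> forests qs (A - B))"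
  have finF: "finite (?F B)" if "B \<in> Pow A" for B
    using fin[OF that] Cons.IH finite_trees by blast
  have "card (forests (q # qs) A) = (\<Sum>B\<in>Pow A. card (?F B))"
    unfolding forests_Cons
  proof (rule card_UN_disjoint)
    show "\<forall>B\<in>Pow A. \<forall>C\<in>Pow A. B \<noteq> C \<longrightarrow> ?F B \<inter> ?F C = {}"
      by (auto simp: trees_def)
  qed (use Cons.prems finF in auto)
  also have "\<dots> = (\<Sum>B\<in>Pow A. card (trees q B) * card (forests qs (A - B)))"
    by (intro sum.cong refl) (subst card_image, auto simp: inj_on_def card_cartesian_product)
  finally have "of_nat (card (forests (q # qs) A)) =
      (\<Sum>B\<in>Pow A. of_nat (card (trees q B)) * of_nat (card (forests qs (A - B))) :: rat)" by simp
  also have "\<dots> = (\<Sum>B\<in>Pow A. (fact (card B) * egf q $ card B) * (fact (?n - card B) * ?P $ (?n - card B)))"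
    using fin Cons.IH by (intro sum.cong refl) (simp add: card_trees)
  \<comment> \<open>The summand depends on \<open>B\<close> only through its size; the binomial
    coefficient then turns the two factorials into \<open>fact ?n\<close>.\<close>
  also have "\<dots> = (\<Sum>j\<le>?n. of_nat (?n choose j) * ((fact j * egf q $ j) * (fact (?n - j) * ?P $ (?n - j))))"
    by (rule sum_Pow_card[OF Cons.prems])
  also have "\<dots> = (\<Sum>j\<le>?n. fact ?n * (egf q $ j * ?P $ (?n - j)))"
    by (intro sum.cong refl) (simp add: binomial_fact field_simps)
  also have "\<dots> = fact ?n * (egf q * ?P) $ ?n"
    by (simp add: fps_mult_nth sum_distrib_left atLeast0AtMost)
  finally show ?case using finF Cons.prems by (auto simp: forests_Cons)
qed

lemma finite_children: "finite A \<Longrightarrow> finite (children k x q A)"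
  by (simp add: children_eq_UN_forests finite_transitions forests_card)

lemma card_children:
  assumes "finite A"
  shows "of_nat (card (children k x q A)) =
    fact (card A) * (\<Sum>qs\<in>transitions k x q. prod_list (map egf qs)) $ card A"
proof -
  have "card (children k x q A) = (\<Sum>qs\<in>transitions k x q. card (forests qs A))"
    unfolding children_eq_UN_forests
  proof (rule card_UN_disjoint)
    have "map run ts = qs" if "ts \<in> forests qs A" for ts qs
      using that by (auto simp: forests_def list_all2_conv_all_nth intro: nth_equalityI)
    then show "\<forall>qs\<in>transitions k x q. \<forall>qs'\<in>transitions k x q. qs \<noteq> qs' \<longrightarrow> forests qs A \<inter> forests qs' A = {}"
      by (metis disjoint_iff)
  qed (use assms forests_card finite_transitions in auto)
  then show ?thesis using forests_card[OF assms] by (simp add: sum_distrib_left fps_sum_nth)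
qed

text \<open>The index set of the equation of \<open>q\<close>. The arity is kept since it yields the
  coefficient \<open>1 / k!\<close>; a state that is not \<open>good\<close> receives no
  terms.\<close>

definition rules :: "'b \<Rightarrow> ((nat \<times> 'a) \<times> 'b list) set" where
  "rules q = (if good q then SIGMA (k, x):(SIGMA n:{1..}. \<Upsilon> n). transitions k x q else {})"

text \<open>Splitting at the root: a single leaf contributes \<open>z\<close>, and a vertex
  contributes its tuples of children in free order, divided by \<open>k!\<close>.\<close>

lemma egf_eq:
  "egf q = fps_of_poly (if q = s0 \<and> good q then [:0, 1:] else 0) +
    (\<Sum>((k, x), qs)\<in>rules q. fps_const (1 / fact k) * prod_list (map egf qs))"
proof (rule fps_ext)
  fix n :: nat
  define A where "A = {1..n}"
  have A: "finite A" "card A = n" by (simp_all add: A_def)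
  let ?S = "SIGMA n:{1..}. \<Upsilon> n"
  define C where "C = (\<lambda>(k, x). {ts \<in> children k x q A. sorted_wrt (<) (map min_leaf ts)})"
  define g where "g = (\<lambda>(k, x). \<Sum>qs\<in>transitions k x q. prod_list (map egf qs))"
  define L where "L = (if q = s0 \<and> good q then {Leaf a | a. A = {a}} else {} :: 'a ptree set)"
  define N where "N = (\<Union>p\<in>?S. Node (snd p) ` C p)"
  have C_sub: "C (k, x) \<subseteq> children k x q A" for k x by (auto simp: C_def)
  have finC: "finite (C p)" for p
    using finite_subset[OF C_sub finite_children[OF A(1)]] by (cases p) simp
  have C: "of_nat (card (C p)) = fact n * (1 / fact (fst p) * g p $ n)" for p
  proof (cases p)
    case (Pair k x)
    have "card (children k x q A) = fact k * card (C (k, x))"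
      unfolding C_def prod.case
    proof (rule card_eq_fact_mult_card_sorted)
      show "finite (children k x q A)" using A by (intro finite_children)
    next
      fix ts assume "ts \<in> children k x q A"
      then show "length ts = k" by (simp add: children_def)
    qed (fact children_distinct children_perm)+
    then have "fact k * of_nat (card (C p)) = (of_nat (card (children k x q A)) :: rat)"
      by (simp only: Pair of_nat_mult of_nat_fact)
    also have "\<dots> = fact n * g p $ n" by (simp only: card_children[OF A(1)] A(2) g_def Pair prod.case)
    finally show ?thesis by (simp only: Pair fst_conv) (simp add: field_simps)
  qed
  have "card N = (\<Sum>p\<in>?S. card (Node (snd p) ` C p))"
    unfolding N_def
  proof (rule card_UN_disjoint)
    \<comment> \<open>One label may occur in several sets \<Upsilon> k; the number of children then
      tells the arity.\<close>
    have len: "length ts = fst p" if "ts \<in> C p" for ts p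
      using that C_sub[of "fst p" "snd p"] by (auto simp: children_def)
    show "\<forall>p\<in>?S. \<forall>p'\<in>?S. p \<noteq> p' \<longrightarrow> Node (snd p) ` C p \<inter> Node (snd p') ` C p' = {}"
    proof (intro ballI impI, rule ccontr)
      fix p p' assume "p \<noteq> p'" "Node (snd p) ` C p \<inter> Node (snd p') ` C p' \<noteq> {}"
      moreover from this obtain ts where "snd p = snd p'" "ts \<in> C p" "ts \<in> C p'" by blast
      ultimately show False using len[of ts p] len[of ts p'] by (simp add: prod_eq_iff)
    qed
  qed (use finite_ops finC in auto)
  also have "\<dots> = (\<Sum>p\<in>?S. card (C p))"
    by (intro sum.cong refl card_image) (simp add: inj_on_def)
  finally have "of_nat (card N) = (\<Sum>p\<in>?S. of_nat (card (C p)) :: rat)" by simp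
  then have N: "of_nat (card N) = fact n * (\<Sum>p\<in>?S. fps_const (1 / fact (fst p)) * g p) $ n"
    by (simp only: C fps_sum_nth fps_mult_left_const_nth sum_distrib_left)
  have L: "of_nat (card L) = fact n * fps_of_poly (if q = s0 \<and> good q then [:0, 1:] else 0) $ n"
  proof -
    have "A = {a} \<longleftrightarrow> n = 1 \<and> a = 1" for a
    proof
      assume "A = {a}"
      moreover from this have "n = 1" using A(2) by simp
      ultimately show "n = 1 \<and> a = 1" by (simp add: A_def)
    qed (simp add: A_def)
    then have "L = (if q = s0 \<and> good q \<and> n = 1 then {Leaf 1} else {})"
      by (cases "q = s0") (simp_all add: L_def)
    then show ?thesis by (simp add: coeff_pCons split: nat.splits)
  qed
  have rules: "(\<Sum>((k, x), qs)\<in>rules q. fps_const (1 / fact k) * prod_list (map egf qs)) =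
      (if good q then \<Sum>p\<in>?S. fps_const (1 / fact (fst p)) * g p else 0)"
  proof (cases "good q")
    case True
    have "(\<Sum>p\<in>?S. fps_const (1 / fact (fst p)) * g p) =
        (\<Sum>p\<in>?S. \<Sum>qs\<in>transitions (fst p) (snd p) q. fps_const (1 / fact (fst p)) * prod_list (map egf qs))"
      by (simp add: g_def case_prod_unfold sum_distrib_left)
    also have "\<dots> = (\<Sum>(p, qs)\<in>(SIGMA p:?S. transitions (fst p) (snd p) q).
        fps_const (1 / fact (fst p)) * prod_list (map egf qs))"
      by (rule sum.Sigma) (use finite_ops finite_transitions in auto)
    finally show ?thesis using True by (simp add: rules_def case_prod_unfold)
  qed (simp add: rules_def)
  have finN: "finite N" unfolding N_def using finite_ops finC by blast
  have finL: "finite L" unfolding L_def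
    by (rule finite_subset[of _ "Leaf ` A"]) (use A in auto)
  have "trees q A = L \<union> (if good q then N else {})"
    unfolding trees_eq[of q A] L_def N_def C_def case_prod_unfold ..
  moreover have "L \<inter> N = {}" unfolding L_def N_def by auto
  ultimately have "card (trees q A) = card L + (if good q then card N else 0)"
    using finN finL by (simp add: card_Un_disjoint)
  then have "of_nat (card (trees q A)) = (of_nat (card L) + (if good q then of_nat (card N) else 0) :: rat)"
    by simp
  then show "egf q $ n = (fps_of_poly (if q = s0 \<and> good q then [:0, 1:] else 0) +
      (\<Sum>((k, x), qs)\<in>rules q. fps_const (1 / fact k) * prod_list (map egf qs))) $ n"
    unfolding rules fps_add_nth L N
    by (cases "good q") (simp_all add: egf_def A_def field_simps)
qed

text \<open>A cycle of unary transitions would produce accepted trees of unbounded size with the same leaves.\<close>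

lemma wf_unary_rules: "wf {(q', q). q \<in> states \<and> (\<exists>m\<in>rules q. snd m = [q'])}" (is "wf ?R")
proof (rule finite_acyclic_wf)
  have sub: "?R \<subseteq> states \<times> states"
    by (auto simp: rules_def transitions_def split: if_splits)
  then show "finite ?R" using finite_states finite_subset by blast
  \<comment> \<open>Each unary transition puts a new root under the tree and keeps its
    leaves.\<close>
  have grow: "\<exists>t'\<in>trees q A. size t < size t'" if "(p, q) \<in> ?R\<^sup>+" "t \<in> trees p A" for p q t A
    using that
  proof (induction rule: trancl_induct)
    case (base q)
    then obtain k x where "good q" "k \<ge> 1" "x \<in> \<Upsilon> k" "[p] \<in> transitions k x q"
      by (auto simp: rules_def split: if_splits)
    then have "Node x [t] \<in> trees q A" using base.prems by (auto simp: trees_def transitions_def)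
    then show ?case by (rule rev_bexI) simp
  next
    case (step q r)
    then obtain u where u: "u \<in> trees q A" "size t < size u" by blast
    obtain k x where "good r" "k \<ge> 1" "x \<in> \<Upsilon> k" "[q] \<in> transitions k x r"
      using step.hyps by (auto simp: rules_def split: if_splits)
    then have "Node x [u] \<in> trees r A" using u by (auto simp: trees_def transitions_def)
    then show ?case by (rule rev_bexI) (use u in simp)
  qed
  show "acyclic ?R"
    unfolding acyclic_def
  proof (intro allI notI)
    fix q assume cyc: "(q, q) \<in> ?R\<^sup>+"
    then have "q \<in> states" using trancl_subset_Sigma[OF sub] by blast
    then obtain A where A: "trees q A \<noteq> {}" by (auto simp: states_def)
    then have "finite A" by (auto simp: trees_def)
    \<comment> \<open>By finiteness there is a largest tree in state \<open>q\<close> with these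
      leaves, but going round the cycle would enlarge it.\<close>
    then have fin: "finite (size ` trees q A)" using finite_trees by blast
    then have "Max (size ` trees q A) \<in> size ` trees q A" using A by (intro Max_in) auto
    then obtain t where t: "t \<in> trees q A" "size t = Max (size ` trees q A)" by auto
    obtain t' where t': "t' \<in> trees q A" "size t < size t'" using grow[OF cyc t(1)] by blast
    then show False using t(2) Max_ge[OF fin imageI[OF t'(1)]] by simp
  qed
qed

text \<open>An accepted tree has exactly one state, so the series is the sum of the
  \<open>egf q\<close>. Their constant terms vanish because every shuffle tree has a leaf.\<close>

theorem algebraic_accepted:
  "\<exists>Q :: rat poly poly. Q \<noteq> 0 \<and> poly (map_poly fps_of_poly Q)
    (Abs_fps (\<lambda>n. of_nat (card {t \<in> shuffle_monomials \<Upsilon> n. accepted t}) / fact n)) = 0"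
proof -
  have "Abs_fps (\<lambda>n. of_nat (card {t \<in> shuffle_monomials \<Upsilon> n. accepted t}) / fact n) = (\<Sum>q\<in>states. egf q)"
  proof (rule fps_ext)
    fix n
    have "{t \<in> shuffle_monomials \<Upsilon> n. accepted t} = (\<Union>q\<in>states. trees q {1..n})"
      using run_mem_states by (fastforce simp: shuffle_monomials_def trees_def)
    moreover have "card (\<Union>q\<in>states. trees q {1..n}) = (\<Sum>q\<in>states. card (trees q {1..n}))"
      by (rule card_UN_disjoint) (use finite_states finite_trees in \<open>auto simp: trees_def\<close>)
    ultimately show "Abs_fps (\<lambda>n. of_nat (card {t \<in> shuffle_monomials \<Upsilon> n. accepted t}) / fact n) $ n
      = (\<Sum>q\<in>states. egf q) $ n"
      by (simp add: fps_sum_nth egf_def sum_divide_distrib)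
  qed
  moreover have "\<exists>Q :: rat poly poly. Q \<noteq> 0 \<and> poly (map_poly fps_of_poly Q) (\<Sum>q\<in>states. egf q) = 0"
  proof (rule algebraic_sum_of_polynomial_system[where l = snd and M = rules and c = "\<lambda>m. 1 / fact (fst (fst m))"])
    show "finite states" by (rule finite_states)
    show "egf q $ 0 = 0" for q by (simp add: egf_def trees_empty)
    show "set (snd m) \<subseteq> states" if "m \<in> rules q" for q m
      using that by (auto simp: rules_def transitions_def split: if_splits)
    show "egf q = fps_of_poly (if q = s0 \<and> good q then [:0, 1:] else 0) +
        (\<Sum>m\<in>rules q. fps_const (1 / fact (fst (fst m))) * prod_list (map egf (snd m)))" for q
      using egf_eq[of q] by (simp add: case_prod_unfold)
    show "wf {(q', q). q \<in> states \<and> (\<exists>m\<in>rules q. snd m = [q'])}" by (rule wf_unary_rules)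
  qed
  ultimately show ?thesis by simp
qed

end

section \<open>Leading monomials of ideals of the free shuffle operad\<close>

lemma well_order_on_ex_greatest:
  assumes "well_order_on X R" "finite K" "K \<noteq> {}" "K \<subseteq> X"
  shows "\<exists>v\<in>K. \<forall>s\<in>K. (s, v) \<in> R"
  using assms(2-4)
proof (induction K rule: finite_ne_induct)
  have lin: "refl_on X R" "trans R" "total_on X R"
    using assms(1) by (auto simp: order_on_defs)
  case (singleton x)
  then show ?case using lin by (auto dest: refl_onD)
next
  have lin: "refl_on X R" "trans R" "total_on X R"
    using assms(1) by (auto simp: order_on_defs)
  case (insert x K)
  then obtain v where v: "v \<in> K" "\<forall>s\<in>K. (s, v) \<in> R" by auto
  have x: "(x, x) \<in> R" using lin insert.prems by (auto dest: refl_onD)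
  show ?case
  proof (cases "(x, v) \<in> R")
    case False
    then have "(v, x) \<in> R"
      using lin(3) insert.prems v x unfolding total_on_def by (metis insert_subset subsetD)
    then have "\<forall>s\<in>K. (s, x) \<in> R" using v(2) lin(2) by (meson transD)
    then show ?thesis using x by blast
  qed (use v in blast)
qed

lemma leading_monomial_eq:
  assumes "well_order_on X R" "v \<in> Poly_Mapping.keys f" "\<forall>s\<in>Poly_Mapping.keys f. (s, v) \<in> R"
  shows "leading_monomial R f = v"
  unfolding leading_monomial_def
proof (rule the_equality)
  have "antisym R" using assms(1) by (auto simp: order_on_defs)
  fix t assume "t \<in> Poly_Mapping.keys f \<and> (\<forall>s\<in>Poly_Mapping.keys f. (s, t) \<in> R)"
  then show "t = v" using assms \<open>antisym R\<close> by (auto dest: antisymD)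
qed (use assms in blast)

lemma leading_monomial_greatest:
  assumes "well_order_on X R" "Poly_Mapping.keys f \<subseteq> X" "f \<noteq> 0"
  shows "leading_monomial R f \<in> Poly_Mapping.keys f \<and>
    (\<forall>s\<in>Poly_Mapping.keys f. (s, leading_monomial R f) \<in> R)"
proof -
  obtain v where "v \<in> Poly_Mapping.keys f" "\<forall>s\<in>Poly_Mapping.keys f. (s, v) \<in> R"
    using well_order_on_ex_greatest[OF assms(1) finite_keys] assms(2,3) by (metis keys_eq_empty)
  then show ?thesis using leading_monomial_eq[OF assms(1)] by metis
qed

text \<open>The images of the normal monomials form a basis. A relation among them would be a kernel
  element with normal leading monomial, and \<open>nonnormal\<close> expresses the image of any
  other monomial through smaller ones. Linearity is stated only on the support \<open>X\<close>,
  because a component of an operad morphism is constrained only there.\<close>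

lemma dim_eq_card_normal:
  fixes scale :: "'k::field \<Rightarrow> 'a::ab_group_add \<Rightarrow> 'a" and \<phi> :: "('m ptree \<Rightarrow>\<^sub>0 'k) \<Rightarrow> 'a"
  assumes vs: "vector_space scale"
    and wo: "well_order_on X R"
    and add: "\<And>f g. Poly_Mapping.keys f \<subseteq> X \<Longrightarrow> Poly_Mapping.keys g \<subseteq> X \<Longrightarrow> \<phi> (f + g) = \<phi> f + \<phi> g"
    and scal: "\<And>c f. Poly_Mapping.keys f \<subseteq> X \<Longrightarrow> \<phi> (Poly_Mapping.map ((*) c) f) = scale c (\<phi> f)"
    and img: "\<phi> ` {f. Poly_Mapping.keys f \<subseteq> X} = W"
    and fin: "finite B" "module.span scale B = W"
    and N: "N \<subseteq> X"
    and normal: "\<And>f. Poly_Mapping.keys f \<subseteq> X \<Longrightarrow> \<phi> f = 0 \<Longrightarrow> f \<noteq> 0 \<Longrightarrow> leading_monomial R f \<notin> N"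
    and nonnormal: "\<And>v. v \<in> X - N \<Longrightarrow> \<exists>f. Poly_Mapping.keys f \<subseteq> X \<and> \<phi> f = 0 \<and>
      v \<in> Poly_Mapping.keys f \<and> (\<forall>s\<in>Poly_Mapping.keys f. (s, v) \<in> R)"
  shows "finite N \<and> vector_space.dim scale W = card N"
proof -
  interpret vector_space scale by (rule vs)
  define b where "b t = \<phi> (Poly_Mapping.single t 1)" for t
  have zero: "\<phi> 0 = 0" using add[of 0 0] by simp
  have single: "\<phi> (Poly_Mapping.single t c) = scale c (b t)" if "t \<in> X" for t c
  proof -
    have "Poly_Mapping.map ((*) c) (Poly_Mapping.single t 1) = Poly_Mapping.single t c"
      by (simp add: map_single)
    then show ?thesis using scal[of "Poly_Mapping.single t 1" c] that by (simp add: b_def)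
  qed
  have sum: "\<phi> (\<Sum>t\<in>T. Poly_Mapping.single t (c t)) = (\<Sum>t\<in>T. scale (c t) (b t))"
    if "finite T" "T \<subseteq> X" for T c
    using that
  proof (induction T rule: finite_induct)
    case (insert t T)
    have "Poly_Mapping.keys (\<Sum>t\<in>T. Poly_Mapping.single t (c t)) \<subseteq> X"
      using insert.prems keys_sum[of "\<lambda>t. Poly_Mapping.single t (c t)" T]
      by (auto split: if_splits)
    then show ?case using insert by (simp add: add single)
  qed (simp add: zero)
  have expand: "\<phi> f = (\<Sum>t\<in>Poly_Mapping.keys f. scale (Poly_Mapping.lookup f t) (b t))"
    if "Poly_Mapping.keys f \<subseteq> X" for f
  proof -
    have "(\<Sum>t\<in>Poly_Mapping.keys f. Poly_Mapping.single t (Poly_Mapping.lookup f t)) = f"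
      by (rule poly_mapping_eqI) (simp add: lookup_sum lookup_single when_def in_keys_iff)
    then show ?thesis using sum[OF finite_keys that, of "Poly_Mapping.lookup f"] by simp
  qed
  have indep: "\<forall>t\<in>T. c t = 0" if T: "finite T" "T \<subseteq> N" and z: "(\<Sum>t\<in>T. scale (c t) (b t)) = 0" for T c
  proof (rule ccontr)
    assume nz: "\<not> (\<forall>t\<in>T. c t = 0)"
    define f where "f = (\<Sum>t\<in>T. Poly_Mapping.single t (c t))"
    have lk: "Poly_Mapping.lookup f t = (if t \<in> T then c t else 0)" for t
      using T(1) by (simp add: f_def lookup_sum lookup_single when_def)
    then have keys: "Poly_Mapping.keys f \<subseteq> T" by (auto simp: in_keys_iff split: if_splits)
    have "f \<noteq> 0" using nz lk by (metis lookup_zero)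
    moreover have "\<phi> f = 0" unfolding f_def using sum[OF T(1)] T(2) N z by simp
    moreover have "Poly_Mapping.keys f \<subseteq> X" using keys T(2) N by blast
    ultimately show False
      using normal[of f] leading_monomial_greatest[OF wo, of f] keys T(2) by blast
  qed
  have inj: "inj_on b N"
  proof (rule inj_onI, rule ccontr)
    fix s t assume st: "s \<in> N" "t \<in> N" "b s = b t" "s \<noteq> t"
    \<comment> \<open>Equal images of different monomials amount to the relation
      \<open>b s - b t = 0\<close>.\<close>
    then have "(\<Sum>u\<in>{s, t}. scale (if u = s then 1 else - 1) (b u)) = 0" by simp
    then show False using indep[of "{s, t}" "\<lambda>u. if u = s then 1 else - 1"] st by auto
  qed
  have "independent (b ` N)"
    unfolding independent_explicit_finite_subsets
  proof (intro allI impI ballI)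
    fix S u v assume S: "S \<subseteq> b ` N" "finite S" "(\<Sum>v\<in>S. scale (u v) v) = 0" "v \<in> S"
    obtain T where T: "T \<subseteq> N" "S = b ` T" using S(1) by (meson subset_imageE)
    then have "finite T" using S(2) inj finite_imageD inj_on_subset by metis
    moreover have "(\<Sum>t\<in>T. scale (u (b t)) (b t)) = 0"
      using S(3) T inj inj_on_subset by (subst (asm) T(2), subst (asm) sum.reindex) auto
    ultimately show "u v = 0" using indep[of T "u \<circ> b"] T S(4) by auto
  qed
  have bW: "b t \<in> W" if "t \<in> X" for t
    unfolding b_def img[symmetric] using that by auto
  have W: "W = span B" using fin by simp
  have wf: "wf (R - Id)" using wo by (simp add: well_order_on_def)
  have "b v \<in> span (b ` N)" if "v \<in> X" for v
    using that
  proof (induction v rule: wf_induct_rule[OF wf])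
    case (1 v)
    show ?case
    proof (cases "v \<in> N")
      case True
      then show ?thesis by (simp add: span_base)
    next
      case False
      then obtain f where f: "Poly_Mapping.keys f \<subseteq> X" "\<phi> f = 0" "v \<in> Poly_Mapping.keys f"
        "\<forall>s\<in>Poly_Mapping.keys f. (s, v) \<in> R" using nonnormal[of v] 1(2) by blast
      let ?K = "Poly_Mapping.keys f" and ?c = "Poly_Mapping.lookup f"
      \<comment> \<open>The vanishing of \<open>\<phi> f\<close> is solved for the term of its
        greatest monomial \<open>v\<close>; the induction hypothesis covers the rest.\<close>
      have "0 = scale (?c v) (b v) + (\<Sum>t\<in>?K - {v}. scale (?c t) (b t))"
        using expand[OF f(1)] f(2,3) by (simp add: sum.remove[of ?K v])
      then have "scale (?c v) (b v) = - (\<Sum>t\<in>?K - {v}. scale (?c t) (b t))"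
        by (simp add: eq_neg_iff_add_eq_0)
      moreover have "(\<Sum>t\<in>?K - {v}. scale (?c t) (b t)) \<in> span (b ` N)"
        using 1(1) f by (intro span_sum span_scale) auto
      ultimately have "scale (?c v) (b v) \<in> span (b ` N)" by (simp add: span_neg)
      then have "scale (inverse (?c v)) (scale (?c v) (b v)) \<in> span (b ` N)" by (rule span_scale)
      then show ?thesis using f(3) by (simp add: in_keys_iff)
    qed
  qed
  then have "W \<subseteq> span (b ` N)"
    using expand unfolding img[symmetric] by (auto intro!: span_sum span_scale)
  moreover have "b ` N \<subseteq> span B" using bW N W by auto
  ultimately have span: "span (b ` N) = W"
    using W span_minimal[OF _ subspace_span, of "b ` N" B] by blast
  \<comment> \<open>An independent set inside the span of the finite set \<open>B\<close> is finite;
    this is how finite dimension bounds the normal monomials.\<close>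
  have "finite (b ` N)"
    using independent_span_bound[OF fin(1) \<open>independent (b ` N)\<close> \<open>b ` N \<subseteq> span B\<close>] by blast
  then have "finite N" using inj finite_imageD by blast
  moreover have "dim W = card (b ` N)"
    using dim_eq_card[of "b ` N" W] span \<open>independent (b ` N)\<close> W by (simp add: span_span)
  ultimately show ?thesis using card_image[OF inj] by simp
qed

subsection \<open>Grafting as a shuffle composition\<close>

definition standardize :: "'x ptree \<Rightarrow> 'x ptree" where
  "standardize t = relabel (rank (set (leaves t))) t"

text \<open>Plain insertion without relabeling. It models a shuffle composition if \<open>a\<close>
  is the minimal leaf of \<open>b\<close> and the only label shared with \<open>t\<close>.\<close>

definition graft :: "nat \<Rightarrow> 'x ptree \<Rightarrow> 'x ptree \<Rightarrow> 'x ptree" where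
  "graft a b t = subst (\<lambda>j. if j = a then b else Leaf j) t"

lemma standardize_monomial:
  assumes "shuffle_tree \<Upsilon> t" "distinct (leaves t)"
  shows "standardize t \<in> shuffle_monomials \<Upsilon> (length (leaves t))"
proof -
  define L where "L = set (leaves t)"
  have mono: "strict_mono_on L (rank L)" by (rule rank_strict_mono) (simp add: L_def)
  have "rank L ` L = {1..length (leaves t)}"
    using rank_image[of L] assms(2) by (simp add: L_def distinct_card)
  moreover have "inj_on (rank L) L" using mono by (rule strict_mono_on_imp_inj_on)
  moreover have "shuffle_tree \<Upsilon> (relabel (rank L) t)"
    using assms(1) mono unfolding L_def by (rule shuffle_tree_relabel)
  ultimately show ?thesis
    unfolding standardize_def L_def[symmetric] shuffle_monomials_def
    using assms(2) by (simp add: distinct_map) (simp add: L_def)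
qed

lemma standardize_id: "t \<in> shuffle_monomials \<Upsilon> n \<Longrightarrow> standardize t = t"
  unfolding standardize_def
  by (rule relabel_id) (auto simp only: shuffle_monomials_def mem_Collect_eq rank_atLeastAtMost)

lemma standardize_unique:
  assumes "strict_mono_on (set (leaves u)) f" "f ` set (leaves u) = {1..k}"
  shows "standardize u = relabel f u"
  unfolding standardize_def
proof (rule relabel_cong)
  fix p assume p: "p \<in> set (leaves u)"
  have "rank {1..k} (f p) = rank (set (leaves u)) p"
    using rank_strict_mono_image[OF assms(1) p] assms(2) by simp
  moreover have "f p \<in> {1..k}" using p assms(2) by blast
  ultimately show "rank (set (leaves u)) p = f p" using rank_atLeastAtMost by simp
qed

lemma set_leaves_graft:
  "a \<in> set (leaves t) \<Longrightarrow> set (leaves (graft a b t)) = set (leaves b) \<union> (set (leaves t) - {a})"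
  by (auto simp: graft_def leaves_subst split: if_splits)

lemma distinct_leaves_graft:
  assumes "distinct (leaves t)" "distinct (leaves b)" "set (leaves b) \<inter> set (leaves t) \<subseteq> {a}"
  shows "distinct (leaves (graft a b t))"
proof -
  have "distinct (concat (map (\<lambda>j. leaves (if j = a then b else Leaf j)) xs))"
    if "distinct xs" "set (leaves b) \<inter> set xs \<subseteq> {a}" for xs
    using that assms(2) by (induction xs) (auto split: if_splits)
  then show ?thesis using assms by (simp add: graft_def leaves_subst)
qed

text \<open>Ranks in the joint label set enumerate \<open>B\<close> on the leaves of
  \<open>b\<close> and the lower labels on those of \<open>t\<close>. Since \<open>a\<close> is
  minimal in \<open>b\<close>, no other label of \<open>b\<close> precedes it; so \<open>a\<close>
  has the same rank in \<open>t\<close> as in the union, namely \<open>Min B\<close>.\<close>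

lemma standardize_graft:
  assumes dist: "distinct (leaves t)" "distinct (leaves b)"
    and a: "a \<in> set (leaves t)" "min_leaf b = a"
    and disj: "set (leaves b) \<inter> set (leaves t) = {a}"
  defines "m \<equiv> length (leaves t)" and "n \<equiv> length (leaves b)"
  defines "B \<equiv> rank (set (leaves (graft a b t))) ` set (leaves b)"
  shows "shuffle_index m n B"
    and "standardize (graft a b t) = shuffle_graft m n B (standardize t) (standardize b)"
    and "length (leaves (graft a b t)) = m + n - 1"
proof -
  define L where "L = set (leaves t)"
  define K where "K = set (leaves b)"
  define U where "U = set (leaves (graft a b t))"
  have fin: "finite L" "finite K" "finite U" by (simp_all add: L_def K_def U_def)
  have U: "U = K \<union> L" using a disj by (auto simp: U_def set_leaves_graft K_def L_def)
  have aK: "a \<in> K" "a \<in> L" "K \<inter> L = {a}" using a disj by (auto simp: K_def L_def)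
  have card: "card L = m" "card K = n" using dist by (simp_all add: L_def K_def m_def n_def distinct_card)
  \<comment> \<open>The shared label \<open>a\<close> is counted twice.\<close>
  have "m + n = card U + 1"
    using card_Un_Int[of K L] fin aK U card by simp
  then have cU: "card U = m + n - 1" by simp
  have "distinct (leaves (graft a b t))" using dist disj by (intro distinct_leaves_graft) auto
  then show "length (leaves (graft a b t)) = m + n - 1"
    using cU by (simp add: U_def distinct_card)
  have mono: "strict_mono_on U (rank U)" using fin by (intro rank_strict_mono)
  then have inj: "inj_on (rank U) U" by (rule strict_mono_on_imp_inj_on)
  have mono_sub: "strict_mono_on K (rank U)" "strict_mono_on L (rank U)"
    using mono U monotone_on_subset by (metis Un_upper1, metis Un_upper2)
  have B: "B = rank U ` K" by (simp add: B_def U_def K_def)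
  have rU: "rank U ` U = {1..m + n - 1}" using rank_image[OF fin(3)] cU by simp
  have cardB: "card B = n"
    using card_image[of "rank U" K] inj U card by (simp add: B inj_on_subset)
  moreover have "B \<subseteq> {1..m + n - 1}" using rU U B by auto
  ultimately show "shuffle_index m n B" by (simp add: shuffle_index_def)
  have min: "a \<le> k" if "k \<in> K" for k
    using that a(2) fin unfolding min_leaf_def K_def by (metis List.finite_set Min_le)
  have MinB: "Min B = rank U a"
  proof (rule Min_eqI)
    show "rank U a \<le> y" if "y \<in> B" for y
      using that min aK strict_mono_on_leD[OF mono_sub(1)] by (auto simp: B)
  qed (use fin aK in \<open>auto simp: B\<close>)
  have "rank U a = rank L a"
  proof -
    have "{q \<in> U. q \<le> a} = {q \<in> L. q \<le> a}"
      using U aK min by (auto dest: antisym)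
    then show ?thesis by (simp add: rank_def)
  qed
  then have MinB': "Min B = rank L a" using MinB by simp
  have lower: "lower_labels m n B = rank U ` L"
  proof -
    have "{1..m + n - 1} - B = rank U ` (U - K)"
      unfolding rU[symmetric] B
      by (rule inj_on_image_set_diff[OF inj, symmetric]) (use U in auto)
    moreover have "L = insert a (U - K)" using U aK by auto
    ultimately show ?thesis by (simp add: lower_labels_def MinB)
  qed
  \<comment> \<open>\<open>rank U\<close> is increasing on \<open>A\<close> and hence respects
    positions; this is used for the labels \<open>K\<close> of \<open>b\<close> and \<open>L\<close>
    of \<open>t\<close>.\<close>
  have enum: "nth_elem (rank U ` A) (rank A p) = rank U p" if "A \<subseteq> U" "p \<in> A" for A p
  proof -
    have A: "strict_mono_on A (rank U)" using mono that(1) monotone_on_subset by blast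
    have "finite (rank U ` A)" using that(1) fin finite_subset by blast
    then have "nth_elem (rank U ` A) (rank (rank U ` A) (rank U p)) = rank U p"
      using that(2) by (intro nth_elem_rank) auto
    then show ?thesis using rank_strict_mono_image[OF A that(2)] by simp
  qed
  have upper: "relabel (nth_elem B) (standardize b) = relabel (rank U) b"
    unfolding standardize_def relabel_relabel
    by (rule relabel_cong) (use enum[of K] U in \<open>simp add: B K_def\<close>)
  have "shuffle_graft m n B (standardize t) (standardize b) =
      subst (\<lambda>j. if j = a then relabel (rank U) b else Leaf (rank U j)) t"
    unfolding shuffle_graft_def standardize_def[of t] relabel_def[of "rank _"] subst_subst
  proof (rule subst_cong)
    fix j assume j: "j \<in> set (leaves t)"
    have "rank L j = Min B \<longleftrightarrow> j = a"
      using strict_mono_on_eqD[OF rank_strict_mono[OF fin(1)], of j a] j aK MinB' by (auto simp: L_def)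
    moreover have "nth_elem (lower_labels m n B) (rank L j) = rank U j"
      using enum[of L j] j U by (simp add: lower L_def)
    ultimately show "subst (\<lambda>j. if j = Min B then relabel (nth_elem B) (standardize b)
          else Leaf (nth_elem (lower_labels m n B) j)) (Leaf (rank (set (leaves t)) j)) =
        (if j = a then subst (\<lambda>a. Leaf (rank U a)) b else Leaf (rank U j))"
      using upper by (simp add: L_def relabel_def)
  qed
  also have "\<dots> = standardize (graft a b t)"
    unfolding standardize_def relabel_def graft_def subst_subst U_def[unfolded graft_def]
    by (rule subst_cong) simp
  finally show "standardize (graft a b t) = shuffle_graft m n B (standardize t) (standardize b)" ..
qed

lemma min_leaf_Leaf [simp]: "min_leaf (Leaf a) = a"
  by (simp add: min_leaf_def)

section \<open>Substitution of trees with prescribed minimal leaves\<close>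

lemma min_leaf_subst:
  assumes "\<And>a. a \<in> set (leaves u) \<Longrightarrow> leaves (f a) \<noteq> [] \<and> min_leaf (f a) = a"
  shows "min_leaf (subst f u) = min_leaf u"
proof (cases "leaves u = []")
  case False
  have sub: "set (leaves u) \<subseteq> set (leaves (subst f u))"
  proof
    fix a assume a: "a \<in> set (leaves u)"
    then have "a \<in> set (leaves (f a))" using assms[OF a] min_leaf_mem[of "f a"] by simp
    then show "a \<in> set (leaves (subst f u))" using a by (auto simp: leaves_subst)
  qed
  show ?thesis
    unfolding min_leaf_def[of "subst f u"]
  proof (rule Min_eqI)
    show "min_leaf u \<in> set (leaves (subst f u))" using sub min_leaf_mem[OF False] by blast
    fix y assume "y \<in> set (leaves (subst f u))"
    then obtain a where a: "a \<in> set (leaves u)" "y \<in> set (leaves (f a))" by (auto simp: leaves_subst)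
    have "min_leaf u \<le> a" unfolding min_leaf_def using a(1) by (intro Min_le) simp_all
    also have "a = min_leaf (f a)" using assms[OF a(1)] by simp
    also have "\<dots> \<le> y" unfolding min_leaf_def using a(2) by (intro Min_le) simp_all
    finally show "min_leaf u \<le> y" .
  qed simp
qed (simp add: min_leaf_def leaves_subst)

text \<open>No minimum of a branch of \<open>u\<close> changes, so the shuffle condition separates
  into one for \<open>u\<close> and one for each inserted tree.\<close>

lemma shuffle_tree_subst:
  assumes "\<And>a. a \<in> set (leaves u) \<Longrightarrow> leaves (f a) \<noteq> [] \<and> min_leaf (f a) = a"
  shows "shuffle_tree \<Upsilon> (subst f u) \<longleftrightarrow> shuffle_tree \<Upsilon> u \<and> (\<forall>a\<in>set (leaves u). shuffle_tree \<Upsilon> (f a))"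
  using assms
proof (induction u)
  case (Node x ts)
  have IH: "shuffle_tree \<Upsilon> (subst f t) \<longleftrightarrow> shuffle_tree \<Upsilon> t \<and> (\<forall>a\<in>set (leaves t). shuffle_tree \<Upsilon> (f a))"
    and min: "min_leaf (subst f t) = min_leaf t" if "t \<in> set ts" for t
  proof -
    have *: "leaves (f a) \<noteq> [] \<and> min_leaf (f a) = a" if "a \<in> set (leaves t)" for a
      using Node.prems[of a] that \<open>t \<in> set ts\<close> by auto
    show "shuffle_tree \<Upsilon> (subst f t) \<longleftrightarrow> shuffle_tree \<Upsilon> t \<and> (\<forall>a\<in>set (leaves t). shuffle_tree \<Upsilon> (f a))"
      using Node.IH[OF that] * by blast
    show "min_leaf (subst f t) = min_leaf t" using min_leaf_subst * by blast
  qed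
  have "map min_leaf (map (subst f) ts) = map min_leaf ts" using min by simp
  then have "sorted_wrt (<) (map min_leaf (map (subst f) ts)) \<longleftrightarrow> sorted_wrt (<) (map min_leaf ts)"
    by (simp only:)
  moreover have "(\<forall>t\<in>set (map (subst f) ts). shuffle_tree \<Upsilon> t) \<longleftrightarrow>
      (\<forall>t\<in>set ts. shuffle_tree \<Upsilon> t) \<and> (\<forall>a\<in>set (leaves (Node x ts)). shuffle_tree \<Upsilon> (f a))"
    using IH by auto
  ultimately show ?case
    unfolding subst.simps shuffle_tree.simps length_map map_is_Nil_conv by blast
qed simp

lemma distinct_concat_map_disjoint:
  "distinct (concat (map F xs)) \<Longrightarrow> i \<in> set xs \<Longrightarrow> j \<in> set xs \<Longrightarrow> i \<noteq> j \<Longrightarrow> set (F i) \<inter> set (F j) = {}"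
  by (induction xs) auto

lemma distinct_concat_map_distinct:
  "distinct (concat (map F xs)) \<Longrightarrow> i \<in> set xs \<Longrightarrow> distinct (F i)"
  by (induction xs) auto

lemma distinct_concat_map_subset:
  assumes "distinct (concat (map F xs))" "\<And>i. i \<in> set xs \<Longrightarrow> distinct (G i) \<and> set (G i) \<subseteq> set (F i)"
  shows "distinct (concat (map G xs))"
  using assms
proof (induction xs)
  case (Cons a xs)
  have G: "distinct (G i)" "set (G i) \<subseteq> set (F i)" if "i \<in> set (a # xs)" for i
    using Cons.prems(2)[OF that] by auto
  have F: "distinct (concat (map F xs))" "set (F a) \<inter> (\<Union>i\<in>set xs. set (F i)) = {}"
    using Cons.prems(1) by auto
  have "distinct (concat (map G xs))" by (rule Cons.IH[OF F(1)]) (use G in simp)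
  moreover have "set (G a) \<inter> (\<Union>i\<in>set xs. set (G i)) = {}"
  proof -
    have "(\<Union>i\<in>set xs. set (G i)) \<subseteq> (\<Union>i\<in>set xs. set (F i))"
      by (rule UN_mono) (use G in simp_all)
    moreover have "set (G a) \<subseteq> set (F a)" using G by simp
    ultimately show ?thesis using F(2) by blast
  qed
  ultimately show ?case using G(1)[of a] by simp
qed simp

lemma branch_shuffle_tree:
  "branch s v \<Longrightarrow> shuffle_tree \<Upsilon> v \<Longrightarrow> distinct (leaves v) \<Longrightarrow> shuffle_tree \<Upsilon> s \<and> distinct (leaves s)"
proof (induction rule: branch.induct)
  case (above u v vs x)
  then show ?case using distinct_concat_map_distinct[of leaves vs v] by auto
qed simp

text \<open>\<open>f\<close> restores the cut branches. Distinctness of the leaves makes it well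
  defined: a leaf of \<open>u\<close> is the minimum of its cut branch and so lies above only one
  child.\<close>

lemma prune_imp_subst:
  assumes "prune u v" "shuffle_tree \<Upsilon> v" "distinct (leaves v)"
  shows "\<exists>f. v = subst f u \<and> (\<forall>a\<in>set (leaves u). leaves (f a) \<noteq> [] \<and> min_leaf (f a) = a)"
  using assms
proof (induction u v rule: prune.induct)
  case (cut v)
  then have "v = subst (\<lambda>_. v) (Leaf (min_leaf v)) \<and> leaves v \<noteq> []" using leaves_nonempty by simp
  then show ?case by (intro exI[of _ "\<lambda>_. v"]) simp
next
  case (node us vs x)
  have len: "length us = length vs" using node.IH by (rule list_all2_lengthD)
  let ?P = "\<lambda>i f. vs ! i = subst f (us ! i) \<and>
    (\<forall>a\<in>set (leaves (us ! i)). leaves (f a) \<noteq> [] \<and> min_leaf (f a) = a)"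
  have "\<exists>f. ?P i f" if "i < length us" for i
  proof -
    have "vs ! i \<in> set vs" using that len by simp
    then have "shuffle_tree \<Upsilon> (vs ! i)" "distinct (leaves (vs ! i))"
      using node.prems distinct_concat_map_distinct[of leaves vs] by auto
    then show ?thesis using list_all2_nthD[OF node.IH that] by blast
  qed
  then obtain F where F: "\<And>i. i < length us \<Longrightarrow> ?P i (F i)" by metis
  have sub: "set (leaves (us ! i)) \<subseteq> set (leaves (vs ! i))" if "i < length us" for i
  proof
    fix a assume a: "a \<in> set (leaves (us ! i))"
    then have "a \<in> set (leaves (F i a))" using F[OF that] min_leaf_mem by metis
    then show "a \<in> set (leaves (vs ! i))" using F[OF that] a by (auto simp: leaves_subst)
  qed
  have dist: "distinct (concat (map (\<lambda>i. leaves (vs ! i)) [0..<length vs]))"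
  proof -
    have "map (\<lambda>i. leaves (vs ! i)) [0..<length vs] = map leaves vs"
      by (rule nth_equalityI) simp_all
    then show ?thesis using node.prems(2) by simp
  qed
  have uniq: "i = j" if "i < length us" "j < length us" "a \<in> set (leaves (us ! i))" "a \<in> set (leaves (us ! j))" for i j a
  proof (rule ccontr)
    assume "i \<noteq> j"
    then have "set (leaves (vs ! i)) \<inter> set (leaves (vs ! j)) = {}"
      using distinct_concat_map_disjoint[OF dist, of i j] that len by simp
    then show False using sub that by blast
  qed
  \<comment> \<open>The functions \<open>F i\<close> of the children are glued; by
    \<open>uniq\<close> the chosen index is the only possible one.\<close>
  define f where "f a = F (SOME i. i < length us \<and> a \<in> set (leaves (us ! i))) a" for a
  have f: "f a = F i a" if "i < length us" "a \<in> set (leaves (us ! i))" for i a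
  proof -
    have "(SOME i. i < length us \<and> a \<in> set (leaves (us ! i))) = i"
      by (rule some_equality) (use uniq that in auto)
    then show ?thesis by (simp add: f_def)
  qed
  have "vs = map (subst f) us"
  proof (rule nth_equalityI)
    fix i assume "i < length vs"
    then have i: "i < length us" using len by simp
    then have "vs ! i = subst (F i) (us ! i)" using F by blast
    also have "\<dots> = subst f (us ! i)" by (rule subst_cong) (use f i in simp)
    finally show "vs ! i = map (subst f) us ! i" using i by simp
  qed (use len in simp)
  moreover have "leaves (f a) \<noteq> [] \<and> min_leaf (f a) = a" if mem: "a \<in> set (leaves (Node x us))" for a
  proof -
    obtain i where "i < length us" "a \<in> set (leaves (us ! i))"
      using mem by (auto simp: set_conv_nth[of us])
    then show ?thesis using F[of i] f[of i a] by simp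
  qed
  ultimately show ?case by (intro exI[of _ f]) simp
qed

lemma graft_absent: "a \<notin> set (leaves t) \<Longrightarrow> graft a b t = t"
proof -
  assume "a \<notin> set (leaves t)"
  then have "graft a b t = subst Leaf t" unfolding graft_def by (intro subst_cong) auto
  then show ?thesis by simp
qed

lemma shuffle_tree_graft:
  assumes "leaves b \<noteq> []" "min_leaf b = a" "shuffle_tree \<Upsilon> t" "shuffle_tree \<Upsilon> b"
  shows "shuffle_tree \<Upsilon> (graft a b t)"
  unfolding graft_def using assms by (subst shuffle_tree_subst) auto

subsection \<open>Monomials divisible by a leading monomial\<close>

text \<open>Several monomials of \<open>f\<close> may have the same image, but only \<open>v\<close>
  is sent to \<open>h v\<close>, so its coefficient survives.\<close>

lemma greatest_key_reindex:
  fixes f :: "'m \<Rightarrow>\<^sub>0 'k::field"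
  assumes v: "v \<in> Poly_Mapping.keys f"
    and less: "\<And>s. s \<in> Poly_Mapping.keys f \<Longrightarrow> s \<noteq> v \<Longrightarrow> (h s, h v) \<in> R - Id"
    and refl: "(h v, h v) \<in> R"
  defines "g \<equiv> \<Sum>s\<in>Poly_Mapping.keys f. Poly_Mapping.single (h s) (Poly_Mapping.lookup f s)"
  shows "h v \<in> Poly_Mapping.keys g" and "\<forall>u\<in>Poly_Mapping.keys g. (u, h v) \<in> R"
proof -
  have "Poly_Mapping.lookup g (h v) =
      (\<Sum>s\<in>Poly_Mapping.keys f. if s = v then Poly_Mapping.lookup f s else 0)"
    unfolding g_def lookup_sum
    by (rule sum.cong) (use less in \<open>auto simp: lookup_single when_def\<close>)
  also have "\<dots> = Poly_Mapping.lookup f v" using v by simp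
  finally show "h v \<in> Poly_Mapping.keys g" using v by (simp add: in_keys_iff)
  have "Poly_Mapping.keys g \<subseteq> h ` Poly_Mapping.keys f"
    unfolding g_def by (rule order_trans[OF keys_sum]) (auto split: if_splits)
  then show "\<forall>u\<in>Poly_Mapping.keys g. (u, h v) \<in> R" using less refl by blast
qed

text \<open>The support condition on \<open>h\<close> spares a general proof that grafts are shuffle
  monomials: below, it follows by comparison in \<open>r\<close> with one composite already known to
  be a shuffle monomial.\<close>

locale shuffle_operad_ideal =
  fixes \<Upsilon> :: "nat \<Rightarrow> 'x set" and r :: "nat \<Rightarrow> ('x ptree \<times> 'x ptree) set"
    and C :: "nat \<Rightarrow> ('x ptree \<Rightarrow>\<^sub>0 'k::field) set"
  assumes order: "admissible_order \<Upsilon> r"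
    and component: "n \<ge> 1 \<Longrightarrow> f \<in> C n \<Longrightarrow> Poly_Mapping.keys f \<subseteq> shuffle_monomials \<Upsilon> n"
    and circ_left: "\<lbrakk>m \<ge> 1; n \<ge> 1; shuffle_index m n B; f \<in> C m; t \<in> shuffle_monomials \<Upsilon> n;
        h = sh_circ (free_shuffle_operad \<Upsilon>) m n B f (Poly_Mapping.single t 1);
        Poly_Mapping.keys h \<subseteq> shuffle_monomials \<Upsilon> (m + n - 1)\<rbrakk> \<Longrightarrow> h \<in> C (m + n - 1)"
    and circ_right: "\<lbrakk>m \<ge> 1; n \<ge> 1; shuffle_index m n B; t \<in> shuffle_monomials \<Upsilon> m; f \<in> C n;
        h = sh_circ (free_shuffle_operad \<Upsilon>) m n B (Poly_Mapping.single t 1) f;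
        Poly_Mapping.keys h \<subseteq> shuffle_monomials \<Upsilon> (m + n - 1)\<rbrakk> \<Longrightarrow> h \<in> C (m + n - 1)"
begin

definition leading :: "nat \<Rightarrow> 'x ptree \<Rightarrow> bool" where
  "leading n v \<longleftrightarrow> (\<exists>f\<in>C n. v \<in> Poly_Mapping.keys f \<and> (\<forall>s\<in>Poly_Mapping.keys f. (s, v) \<in> r n))"

lemma well_order: "n \<ge> 1 \<Longrightarrow> well_order_on (shuffle_monomials \<Upsilon> n) (r n)"
  using order by (simp add: admissible_order_def)

lemma r_refl: "n \<ge> 1 \<Longrightarrow> v \<in> shuffle_monomials \<Upsilon> n \<Longrightarrow> (v, v) \<in> r n"
  using well_order[of n] by (auto simp: order_on_defs dest: refl_onD)

lemma r_mem: "n \<ge> 1 \<Longrightarrow> (s, v) \<in> r n \<Longrightarrow> s \<in> shuffle_monomials \<Upsilon> n"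
  using well_order[of n] well_order_on_domain by fast

text \<open>Admissibility makes grafting strictly increasing in the lower tree, so composing a
  kernel element with \<open>t\<close> keeps its leading term on top.\<close>

lemma leading_shuffle_graft_left:
  assumes mn: "m \<ge> 1" "n \<ge> 1" and B: "shuffle_index m n B"
    and s: "leading m s" and t: "t \<in> shuffle_monomials \<Upsilon> n"
    and mem: "shuffle_graft m n B s t \<in> shuffle_monomials \<Upsilon> (m + n - 1)"
  shows "leading (m + n - 1) (shuffle_graft m n B s t)"
proof -
  have mn1: "m + n - 1 \<ge> 1" using mn by simp
  obtain f where f: "f \<in> C m" "s \<in> Poly_Mapping.keys f" "\<forall>s'\<in>Poly_Mapping.keys f. (s', s) \<in> r m"
    using s by (auto simp: leading_def)
  define g where "g = (\<Sum>s'\<in>Poly_Mapping.keys f.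
    Poly_Mapping.single (shuffle_graft m n B s' t) (Poly_Mapping.lookup f s'))"
  have less: "(shuffle_graft m n B s' t, shuffle_graft m n B s t) \<in> r (m + n - 1) - Id"
    if "s' \<in> Poly_Mapping.keys f" "s' \<noteq> s" for s'
  proof -
    have "(s', s) \<in> r m - Id" using f(3) that by simp
    then show ?thesis using order mn B t unfolding admissible_order_def by blast
  qed
  note g = greatest_key_reindex[where h = "\<lambda>s'. shuffle_graft m n B s' t",
      OF f(2) less r_refl[OF mn1 mem], folded g_def]
  have "g \<in> C (m + n - 1)"
  proof (rule circ_left[OF mn B f(1) t])
    show "g = sh_circ (free_shuffle_operad \<Upsilon>) m n B f (Poly_Mapping.single t 1)"
      by (simp add: g_def free_shuffle_operad_def)
    show "Poly_Mapping.keys g \<subseteq> shuffle_monomials \<Upsilon> (m + n - 1)" using g(2) r_mem[OF mn1] by blast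
  qed
  then show ?thesis using g by (auto simp: leading_def)
qed

lemma leading_shuffle_graft_right:
  assumes mn: "m \<ge> 1" "n \<ge> 1" and B: "shuffle_index m n B"
    and s: "s \<in> shuffle_monomials \<Upsilon> m" and t: "leading n t"
    and mem: "shuffle_graft m n B s t \<in> shuffle_monomials \<Upsilon> (m + n - 1)"
  shows "leading (m + n - 1) (shuffle_graft m n B s t)"
proof -
  have mn1: "m + n - 1 \<ge> 1" using mn by simp
  obtain f where f: "f \<in> C n" "t \<in> Poly_Mapping.keys f" "\<forall>t'\<in>Poly_Mapping.keys f. (t', t) \<in> r n"
    using t by (auto simp: leading_def)
  define g where "g = (\<Sum>t'\<in>Poly_Mapping.keys f.
    Poly_Mapping.single (shuffle_graft m n B s t') (Poly_Mapping.lookup f t'))"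
  have less: "(shuffle_graft m n B s t', shuffle_graft m n B s t) \<in> r (m + n - 1) - Id"
    if "t' \<in> Poly_Mapping.keys f" "t' \<noteq> t" for t'
  proof -
    have "(t', t) \<in> r n - Id" using f(3) that by simp
    then show ?thesis using order mn B s unfolding admissible_order_def by blast
  qed
  note g = greatest_key_reindex[where h = "shuffle_graft m n B s",
      OF f(2) less r_refl[OF mn1 mem], folded g_def]
  have "g \<in> C (m + n - 1)"
  proof (rule circ_right[OF mn B s f(1)])
    show "g = sh_circ (free_shuffle_operad \<Upsilon>) m n B (Poly_Mapping.single s 1) f"
      by (simp add: g_def free_shuffle_operad_def)
    show "Poly_Mapping.keys g \<subseteq> shuffle_monomials \<Upsilon> (m + n - 1)" using g(2) r_mem[OF mn1] by blast
  qed
  then show ?thesis using g by (auto simp: leading_def)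
qed

text \<open>Extends \<open>leading\<close> to subtrees, whose labels may have gaps, so that
  composites can be built by plain grafting.\<close>

definition std_leading :: "'x ptree \<Rightarrow> bool" where
  "std_leading t \<longleftrightarrow> leading (length (leaves t)) (standardize t)"

lemma std_leading_graft:
  assumes t: "shuffle_tree \<Upsilon> t" "distinct (leaves t)" and b: "shuffle_tree \<Upsilon> b" "distinct (leaves b)"
    and a: "a \<in> set (leaves t)" "min_leaf b = a" "set (leaves b) \<inter> set (leaves t) = {a}"
    and lead: "std_leading t \<or> std_leading b"
  shows "std_leading (graft a b t)"
proof -
  let ?m = "length (leaves t)" and ?n = "length (leaves b)"
  let ?B = "rank (set (leaves (graft a b t))) ` set (leaves b)"
  have mn: "?m \<ge> 1" "?n \<ge> 1"
    using leaves_nonempty[OF t(1)] leaves_nonempty[OF b(1)] by (simp_all add: Suc_le_eq)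
  note S = standardize_graft[OF t(2) b(2) a]
  have tb: "standardize t \<in> shuffle_monomials \<Upsilon> ?m" "standardize b \<in> shuffle_monomials \<Upsilon> ?n"
    using standardize_monomial t b by blast+
  have "shuffle_tree \<Upsilon> (graft a b t)"
    using shuffle_tree_graft[OF leaves_nonempty[OF b(1)] a(2) t(1) b(1)] .
  moreover have "distinct (leaves (graft a b t))" using distinct_leaves_graft[OF t(2) b(2)] a(3) by blast
  ultimately have mem: "shuffle_graft ?m ?n ?B (standardize t) (standardize b)
      \<in> shuffle_monomials \<Upsilon> (?m + ?n - 1)"
    using standardize_monomial[of \<Upsilon> "graft a b t"] S(2,3) by simp
  then have "leading (?m + ?n - 1) (shuffle_graft ?m ?n ?B (standardize t) (standardize b))"
    using lead leading_shuffle_graft_left[OF mn S(1) _ tb(2)] leading_shuffle_graft_right[OF mn S(1) tb(1)]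
    unfolding std_leading_def by blast
  then show ?thesis unfolding std_leading_def S(2,3) .
qed

text \<open>The branches are grafted one leaf at a time, each time by a shuffle composition;
  \<open>g A\<close> is the stage at which the leaves in \<open>A\<close> have been
  replaced.\<close>

lemma std_leading_subst:
  assumes u: "shuffle_tree \<Upsilon> u" "std_leading u" and dist: "distinct (leaves (subst f u))"
    and f: "\<And>a. a \<in> set (leaves u) \<Longrightarrow> shuffle_tree \<Upsilon> (f a) \<and> min_leaf (f a) = a"
  shows "std_leading (subst f u)"
proof -
  define g where "g A j = (if j \<in> A then f j else Leaf j)" for A j
  have dist': "distinct (concat (map (\<lambda>a. leaves (f a)) (leaves u)))" using dist by (simp add: leaves_subst)
  have ne: "leaves (f a) \<noteq> []" "a \<in> set (leaves (f a))" if "a \<in> set (leaves u)" for a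
    using f[OF that] leaves_nonempty min_leaf_mem by metis+
  have disj: "set (leaves (f a)) \<inter> set (leaves (f b)) = {}"
    if "a \<in> set (leaves u)" "b \<in> set (leaves u)" "a \<noteq> b" for a b
    using distinct_concat_map_disjoint[OF dist'] that by simp
  have "std_leading (subst (g A) u)" if "finite A" "A \<subseteq> set (leaves u)" for A
    using that
  proof (induction A rule: finite_induct)
    case empty
    have "subst (g {}) u = subst Leaf u" by (rule subst_cong) (simp add: g_def)
    then show ?case using u(2) by simp
  next
    case (insert a A)
    let ?t = "subst (g A) u"
    have a: "a \<in> set (leaves u)" "A \<subseteq> set (leaves u)" using insert.prems by auto
    have g: "leaves (g A j) \<noteq> [] \<and> min_leaf (g A j) = j \<and> shuffle_tree \<Upsilon> (g A j)"
      and g_sub: "distinct (leaves (g A j)) \<and> set (leaves (g A j)) \<subseteq> set (leaves (f j))"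
      if "j \<in> set (leaves u)" for j
      using f[OF that] ne[OF that] distinct_concat_map_distinct[OF dist' that] by (auto simp: g_def)
    have shuffle: "shuffle_tree \<Upsilon> ?t"
      using shuffle_tree_subst[of u "g A" \<Upsilon>] g u(1) by blast
    have dist_t: "distinct (leaves ?t)"
      using distinct_concat_map_subset[OF dist', of "\<lambda>j. leaves (g A j)"] g_sub by (simp add: leaves_subst)
    have ga: "g A a = Leaf a" using insert.hyps(2) by (simp add: g_def)
    have mem: "a \<in> set (leaves ?t)"
      using a(1) ga by (auto simp: leaves_subst intro!: bexI[of _ a])
    \<comment> \<open>\<open>a\<close> is still a leaf at this stage, and all other labels belong to
      branches disjoint from \<open>f a\<close>.\<close>
    have inter: "set (leaves (f a)) \<inter> set (leaves ?t) = {a}"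
    proof -
      have "y = a" if y: "y \<in> set (leaves (f a))" "y \<in> set (leaves ?t)" for y
      proof -
        obtain j where j: "j \<in> set (leaves u)" "y \<in> set (leaves (g A j))"
          using y(2) by (auto simp: leaves_subst)
        show "y = a"
        proof (cases "j = a")
          case True
          then show ?thesis using j(2) ga by simp
        next
          case False
          then show ?thesis using disj[OF a(1) j(1)] g_sub[OF j(1)] j(2) y(1) by blast
        qed
      qed
      then show ?thesis using mem ne[OF a(1)] by blast
    qed
    have "graft a (f a) ?t = subst (g (insert a A)) u"
      unfolding graft_def subst_subst
    proof (rule subst_cong)
      fix j assume j: "j \<in> set (leaves u)"
      show "subst (\<lambda>k. if k = a then f a else Leaf k) (g A j) = g (insert a A) j"
      proof (cases "j = a")
        case True
        then show ?thesis using ga by (simp add: g_def)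
      next
        case False
        then have "a \<notin> set (leaves (g A j))"
          using disj[OF a(1) j] ne[OF a(1)] g_sub[OF j] by blast
        then show ?thesis using graft_absent[of a "g A j" "f a"] False by (simp add: graft_def g_def)
      qed
    qed
    moreover have "std_leading (graft a (f a) ?t)"
      using std_leading_graft[OF shuffle dist_t _ _ mem _ inter] f[OF a(1)] insert.IH[OF a(2)]
        distinct_concat_map_distinct[OF dist' a(1)] by blast
    ultimately show ?case by simp
  qed
  then have "std_leading (subst (g (set (leaves u))) u)" by simp
  moreover have "subst (g (set (leaves u))) u = subst f u"
    by (rule subst_cong) (simp add: g_def)
  ultimately show ?thesis by simp
qed

text \<open>One step towards the root: \<open>Node x vs\<close> arises by grafting the child
  \<open>w\<close> into the same tree with \<open>w\<close> cut down to its minimal leaf.\<close>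

lemma std_leading_branch:
  "branch s v \<Longrightarrow> shuffle_tree \<Upsilon> v \<Longrightarrow> distinct (leaves v) \<Longrightarrow> std_leading s \<Longrightarrow> std_leading v"
proof (induction rule: branch.induct)
  case (above s w vs x)
  obtain xs ys where vs: "vs = xs @ w # ys" using above.hyps(2) by (meson split_list)
  let ?a = "min_leaf w"
  let ?t = "Node x (xs @ Leaf ?a # ys)"
  have w: "shuffle_tree \<Upsilon> w" "distinct (leaves w)" using above.prems vs by auto
  then have ne: "?a \<in> set (leaves w)" using leaves_nonempty min_leaf_mem by blast
  have t: "shuffle_tree \<Upsilon> ?t" "distinct (leaves ?t)" using above.prems vs ne by auto
  have disj: "set (leaves w) \<inter> (\<Union>u\<in>set xs \<union> set ys. set (leaves u)) = {}"
    using above.prems(2) vs by auto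
  have "graft ?a w u = u" if "u \<in> set xs \<union> set ys" for u
    using graft_absent[of ?a u w] that disj ne by blast
  then have "graft ?a w ?t = Node x vs"
    using vs by (simp add: graft_def map_idI)
  moreover have "std_leading (graft ?a w ?t)"
    by (rule std_leading_graft[OF t w _ refl]) (use disj ne above w in auto)
  ultimately show ?case by simp
qed simp

text \<open>\<open>w\<close> is the standardized form of a subtree \<open>u\<close> of
  \<open>v\<close>. Restoring first the branches cut off above \<open>u\<close> and then what lies
  below it preserves being leading, as both are shuffle compositions.\<close>

lemma leading_divides:
  assumes "leading k w" "k \<ge> 1" "divides w v" "v \<in> shuffle_monomials \<Upsilon> n"
  shows "leading n v"
proof -
  obtain s u f where s: "branch s v" "prune u s" and f: "strict_mono_on (set (leaves u)) f" "w = relabel f u"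
    using assms(3) by (auto simp: divides_def connected_subtree_def)
  have v: "shuffle_tree \<Upsilon> v" "distinct (leaves v)" "set (leaves v) = {1..n}"
    using assms(4) by (auto simp: shuffle_monomials_def)
  have shuffle_s: "shuffle_tree \<Upsilon> s" "distinct (leaves s)" using branch_shuffle_tree[OF s(1) v(1,2)] by auto
  obtain g where g: "s = subst g u" "\<forall>a\<in>set (leaves u). leaves (g a) \<noteq> [] \<and> min_leaf (g a) = a"
    using prune_imp_subst[OF s(2) shuffle_s] by blast
  have u: "shuffle_tree \<Upsilon> u" "\<forall>a\<in>set (leaves u). shuffle_tree \<Upsilon> (g a)"
    using shuffle_tree_subst[of u g \<Upsilon>] g shuffle_s(1) by auto
  have "w \<in> shuffle_monomials \<Upsilon> k"
    using assms(1) component[OF assms(2)] by (auto simp: leading_def)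
  then have w: "distinct (leaves w)" "set (leaves w) = {1..k}" by (auto simp: shuffle_monomials_def)
  have "length (leaves u) = k" using f(2) w distinct_card[OF w(1)] by simp
  moreover have "standardize u = w" using standardize_unique[OF f(1), of k] w(2) f(2) by simp
  ultimately have "std_leading u" using assms(1) by (simp add: std_leading_def)
  then have "std_leading s"
    unfolding g(1) by (rule std_leading_subst[OF u(1)]) (use g u shuffle_s in auto)
  then have "std_leading v" using std_leading_branch[OF s(1) v(1,2)] by blast
  then show ?thesis
    using standardize_id[OF assms(4)] distinct_card[OF v(2)] v(3) by (simp add: std_leading_def)
qed

end

section \<open>Normal monomials form a regular tree language\<close>

lemma finite_branches: "finite {s. branch s t}"
proof (induction t)
  case (Leaf a)
  have "{s. branch s (Leaf a)} \<subseteq> {Leaf a}" by (auto elim: branch.cases)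
  then show ?case by (rule finite_subset) simp
next
  case (Node x ts)
  have "{s. branch s (Node x ts)} \<subseteq> insert (Node x ts) (\<Union>t\<in>set ts. {s. branch s t})"
    by (auto elim: branch.cases)
  then show ?case by (rule finite_subset) (use Node in auto)
qed

lemma branch_trans: "branch t u \<Longrightarrow> branch s t \<Longrightarrow> branch s u"
  by (induction rule: branch.induct) (auto intro: branch.above)

lemma branch_Leaf_iff: "branch s (Leaf a) \<longleftrightarrow> s = Leaf a"
  by (auto elim: branch.cases intro: branch.here)

lemma branch_Node_iff: "branch s (Node x ts) \<longleftrightarrow> s = Node x ts \<or> (\<exists>t\<in>set ts. branch s t)"
  by (auto elim: branch.cases intro: branch.intros)

lemma prune_Leaf_iff: "prune u (Leaf a) \<longleftrightarrow> u = Leaf a"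
proof
  assume "prune u (Leaf a)"
  then show "u = Leaf a" by cases simp
next
  assume "u = Leaf a"
  then show "prune u (Leaf a)" using prune.cut[of "Leaf a"] by simp
qed

lemma prune_Node_iff:
  "prune u (Node x ts) \<longleftrightarrow> u = Leaf (min_leaf (Node x ts)) \<or> (\<exists>us. u = Node x us \<and> list_all2 prune us ts)"
  by (auto elim: prune.cases intro: prune.intros)

locale tree_patterns =
  fixes \<Upsilon> :: "nat \<Rightarrow> 'x set" and M :: "'x ptree set"
  assumes finite_ops: "finite (SIGMA n:{1..}. \<Upsilon> n)" and finite_M: "finite M"
begin

definition parts :: "'x skeleton set" where
  "parts = tree_skeleton ` {s. \<exists>m\<in>M. branch s m}"

text \<open>The state of a tree is the set of those parts of patterns that occur at its root.\<close>

definition root_parts :: "'x \<Rightarrow> 'x skeleton set list \<Rightarrow> 'x skeleton set" where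
  "root_parts x qs = {\<sigma> \<in> parts. \<sigma> = SLeaf \<or> (\<exists>\<sigma>s. list_all2 (\<in>) \<sigma>s qs \<and> \<sigma> = SNode x (mset \<sigma>s))}"

lemma finite_parts: "finite parts"
proof -
  have "{s. \<exists>m\<in>M. branch s m} = (\<Union>m\<in>M. {s. branch s m})" by auto
  then show ?thesis
    unfolding parts_def by (simp only:) (intro finite_imageI finite_UN_I finite_M finite_branches)
qed

lemma skeleton_M_parts: "tree_skeleton ` M \<subseteq> parts"
  by (auto simp: parts_def intro: branch.here)

text \<open>Closure under children: the states of the children report only skeletons in
  \<open>parts\<close>, and by this lemma nothing relevant is lost.\<close>

lemma parts_SNode:
  assumes "SNode x N \<in> parts" "\<tau> \<in># N"
  shows "\<tau> \<in> parts"
proof -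
  obtain s m where s: "m \<in> M" "branch s m" "tree_skeleton s = SNode x N"
    using assms(1) by (auto simp: parts_def)
  then obtain ts where ts: "s = Node x ts" "N = mset (map tree_skeleton ts)" by (cases s) auto
  then obtain t where t: "t \<in> set ts" "\<tau> = tree_skeleton t" using assms(2) by auto
  then have "branch t s" using ts(1) by (auto intro: branch.intros)
  then have "branch t m" using branch_trans[OF s(2)] by blast
  then show ?thesis using s(1) t(2) by (auto simp: parts_def)
qed

text \<open>The chosen skeletons are permuted along with the child states, and \<open>SNode\<close>
  keeps only their multiset.\<close>

lemma root_parts_mono_perm:
  assumes "mset qs = mset qs'"
  shows "root_parts x qs \<subseteq> root_parts x qs'"
proof
  fix \<sigma> assume \<sigma>: "\<sigma> \<in> root_parts x qs"
  show "\<sigma> \<in> root_parts x qs'"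
  proof (cases "\<sigma> = SLeaf")
    case False
    then obtain \<sigma>s where "list_all2 (\<in>) \<sigma>s qs" "\<sigma> = SNode x (mset \<sigma>s)" using \<sigma> by (auto simp: root_parts_def)
    moreover have "list_all2 (\<lambda>q \<sigma>. \<sigma> \<in> q) qs \<sigma>s"
      using calculation(1) by (simp add: list_all2_conv_all_nth)
    then obtain \<tau>s where "list_all2 (\<lambda>q \<sigma>. \<sigma> \<in> q) qs' \<tau>s" "mset \<tau>s = mset \<sigma>s"
      using list_all2_reorder_left_invariance[OF _ assms[symmetric]] by blast
    then have "list_all2 (\<in>) \<tau>s qs'" "mset \<tau>s = mset \<sigma>s" by (simp_all add: list_all2_conv_all_nth)
    ultimately have "\<sigma> \<in> parts" "list_all2 (\<in>) \<tau>s qs'" "\<sigma> = SNode x (mset \<tau>s)"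
      using \<sigma> by (simp_all add: root_parts_def)
    then show ?thesis unfolding root_parts_def by blast
  qed (use \<sigma> in \<open>simp add: root_parts_def\<close>)
qed

text \<open>The intersection covers the case that \<open>SLeaf\<close> is not a part, for instance
  when \<open>M\<close> is empty. A state is bad as soon as it contains the skeleton of a whole
  pattern.\<close>

sublocale tree_automaton \<Upsilon> "Pow parts" "parts \<inter> {SLeaf}" root_parts "\<lambda>q. q \<inter> tree_skeleton ` M = {}"
proof
  show "root_parts x qs = root_parts x qs'" if "mset qs = mset qs'" for x qs qs'
    using root_parts_mono_perm[OF that] root_parts_mono_perm[OF that[symmetric]] by blast
qed (fact finite_ops, auto simp: finite_parts root_parts_def)

text \<open>A pruning either cuts at the root, which gives \<open>SLeaf\<close>, or prunes every
  child separately; \<open>root_parts\<close> imitates this alternative.\<close>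

lemma run_eq: "run t = {\<sigma> \<in> parts. \<exists>u. prune u t \<and> tree_skeleton u = \<sigma>}"
proof (induction t)
  case (Leaf a)
  then show ?case by (auto simp: prune_Leaf_iff)
next
  case (Node x ts)
  show ?case
  proof (intro equalityI subsetI)
    fix \<sigma> assume "\<sigma> \<in> run (Node x ts)"
    then have \<sigma>: "\<sigma> \<in> root_parts x (map run ts)" by simp
    then have part: "\<sigma> \<in> parts" by (simp add: root_parts_def)
    have "\<exists>u. prune u (Node x ts) \<and> tree_skeleton u = \<sigma>"
    proof (cases "\<sigma> = SLeaf")
      case True
      then show ?thesis by (intro exI[of _ "Leaf (min_leaf (Node x ts))"]) (simp add: prune.cut)
    next
      case False
      then obtain \<sigma>s where \<sigma>s: "list_all2 (\<in>) \<sigma>s (map run ts)" "\<sigma> = SNode x (mset \<sigma>s)"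
        using \<sigma> by (auto simp: root_parts_def)
      have len: "length \<sigma>s = length ts" using list_all2_lengthD[OF \<sigma>s(1)] by simp
      have "\<exists>u. prune u (ts ! i) \<and> tree_skeleton u = \<sigma>s ! i" if "i < length ts" for i
      proof -
        have "\<sigma>s ! i \<in> run (ts ! i)" using list_all2_nthD2[OF \<sigma>s(1), of i] that by simp
        then show ?thesis using Node.IH[OF nth_mem[OF that]] by blast
      qed
      then obtain u where u: "\<And>i. i < length ts \<Longrightarrow> prune (u i) (ts ! i) \<and> tree_skeleton (u i) = \<sigma>s ! i"
        by metis
      define us where "us = map u [0..<length ts]"
      have "list_all2 prune us ts" using u by (simp add: us_def list_all2_conv_all_nth)
      then have "prune (Node x us) (Node x ts)" by (rule prune.node)
      moreover have "map tree_skeleton us = \<sigma>s"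
        by (rule nth_equalityI) (use u len in \<open>simp_all add: us_def\<close>)
      then have "tree_skeleton (Node x us) = \<sigma>" using \<sigma>s(2) by (simp only: tree_skeleton.simps)
      ultimately show ?thesis by blast
    qed
    then show "\<sigma> \<in> {\<sigma> \<in> parts. \<exists>u. prune u (Node x ts) \<and> tree_skeleton u = \<sigma>}" using part by blast
  next
    fix \<sigma> assume "\<sigma> \<in> {\<sigma> \<in> parts. \<exists>u. prune u (Node x ts) \<and> tree_skeleton u = \<sigma>}"
    then obtain u where part: "\<sigma> \<in> parts" and u: "prune u (Node x ts)" "tree_skeleton u = \<sigma>" by blast
    then consider "\<sigma> = SLeaf" | us where "u = Node x us" "list_all2 prune us ts"
      unfolding prune_Node_iff by auto
    then show "\<sigma> \<in> run (Node x ts)"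
    proof cases
      case 1
      then show ?thesis using part unfolding run.simps root_parts_def by blast
    next
      case 2
      have \<sigma>: "\<sigma> = SNode x (mset (map tree_skeleton us))" using 2(1) u(2) by simp
      have "list_all2 (\<in>) (map tree_skeleton us) (map run ts)"
        unfolding list_all2_conv_all_nth length_map
      proof (intro conjI allI impI)
        show len: "length us = length ts" using 2(2) by (rule list_all2_lengthD)
        fix i assume i: "i < length us"
        have "tree_skeleton (us ! i) \<in> parts"
          using parts_SNode[of x "mset (map tree_skeleton us)"] part \<sigma> i by simp
        moreover have "prune (us ! i) (ts ! i)" using list_all2_nthD[OF 2(2) i] .
        ultimately have "tree_skeleton (us ! i) \<in> run (ts ! i)"
          using Node.IH[of "ts ! i"] i len by auto
        then show "map tree_skeleton us ! i \<in> map run ts ! i" using i len by simp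
      qed
      then show ?thesis using part \<sigma> unfolding run.simps root_parts_def by blast
    qed
  qed
qed

lemma accepted_iff_branch: "accepted t \<longleftrightarrow> (\<forall>s. branch s t \<longrightarrow> run s \<inter> tree_skeleton ` M = {})"
proof (induction t)
  case (Leaf a)
  then show ?case by (simp add: branch_Leaf_iff)
next
  case (Node x ts)
  have "accepted (Node x ts) \<longleftrightarrow> run (Node x ts) \<inter> tree_skeleton ` M = {} \<and> (\<forall>t\<in>set ts. accepted t)"
    by simp
  then show ?case unfolding branch_Node_iff using Node.IH by blast
qed

lemma accepted_iff:
  "accepted t \<longleftrightarrow> \<not> (\<exists>u. connected_subtree u t \<and> tree_skeleton u \<in> tree_skeleton ` M)"
  unfolding accepted_iff_branch run_eq connected_subtree_def using skeleton_M_parts by blast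

text \<open>Acceptance sees skeletons, divisibility sees the order of the leaves. Symmetric
  regularity bridges the gap: a subtree with the skeleton of a pattern becomes, once standardized, a
  shuffle monomial with that skeleton and so belongs to \<open>M\<close>.\<close>

lemma not_accepted_iff_divides:
  assumes M: "M \<subseteq> (\<Union>n\<in>{1..}. shuffle_monomials \<Upsilon> n)" and reg: "symmetric_regular \<Upsilon> M"
    and t: "t \<in> shuffle_monomials \<Upsilon> n"
  shows "\<not> accepted t \<longleftrightarrow> (\<exists>w\<in>M. divides w t)"
proof
  assume "\<exists>w\<in>M. divides w t"
  then obtain w u f where "w \<in> M" "connected_subtree u t" "w = relabel f u" by (auto simp: divides_def)
  then show "\<not> accepted t" unfolding accepted_iff by (metis imageI tree_skeleton_relabel)
next
  assume "\<not> accepted t"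
  then obtain u m where u: "connected_subtree u t" "m \<in> M" "tree_skeleton u = tree_skeleton m"
    unfolding accepted_iff by auto
  then obtain s where s: "branch s t" "prune u s" by (auto simp: connected_subtree_def)
  have "shuffle_tree \<Upsilon> t" "distinct (leaves t)" using t by (auto simp: shuffle_monomials_def)
  then have shuffle_s: "shuffle_tree \<Upsilon> s" "distinct (leaves s)" using branch_shuffle_tree[OF s(1)] by auto
  obtain g where g: "s = subst g u" "\<forall>a\<in>set (leaves u). leaves (g a) \<noteq> [] \<and> min_leaf (g a) = a"
    using prune_imp_subst[OF s(2) shuffle_s] by blast
  have "shuffle_tree \<Upsilon> u" using shuffle_tree_subst[of u g \<Upsilon>] g shuffle_s(1) by auto
  moreover have "distinct (leaves u)"
  proof -
    have "distinct (concat (map (\<lambda>a. leaves (g a)) (leaves u)))" using shuffle_s(2) g(1) by (simp add: leaves_subst)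
    then have "distinct (concat (map (\<lambda>a. [a]) (leaves u)))"
      by (rule distinct_concat_map_subset) (use g(2) min_leaf_mem in fastforce)
    then show ?thesis by simp
  qed
  ultimately have "standardize u \<in> shuffle_monomials \<Upsilon> (length (leaves u))" by (rule standardize_monomial)
  then have "standardize u \<in> M"
    using reg u(2,3) unfolding symmetric_regular_def standardize_def by (metis tree_skeleton_relabel)
  moreover have "divides (standardize u) t"
    unfolding divides_def standardize_def using u(1) rank_strict_mono[of "set (leaves u)"] by blast
  ultimately show "\<exists>w\<in>M. divides w t" by blast
qed

end

section \<open>The kernel of the presentation as an ideal, and the conclusion\<close>

lemma shuffle_operad_ideal_kernel:
  fixes P :: "('k::field, 'a::ab_group_add) symmetric_operad" and \<Upsilon> :: "nat \<Rightarrow> 'x set"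
  assumes order: "admissible_order \<Upsilon> r"
    and hom: "shuffle_operad_hom (free_shuffle_operad \<Upsilon>) (forget P) \<pi>"
  shows "shuffle_operad_ideal \<Upsilon> r (kernel (free_shuffle_operad \<Upsilon>) \<pi>)"
proof -
  let ?F = "free_shuffle_operad \<Upsilon> :: ('k, 'x ptree \<Rightarrow>\<^sub>0 'k) shuffle_operad"
  have comp: "f \<in> sh_component ?F n \<longleftrightarrow> Poly_Mapping.keys f \<subseteq> shuffle_monomials \<Upsilon> n" for f n
    by (simp add: free_shuffle_operad_def)
  have add: "\<pi> n (f + g) = \<pi> n f + \<pi> n g" if "n \<ge> 1" "f \<in> sh_component ?F n" "g \<in> sh_component ?F n" for n f g
    using hom that unfolding shuffle_operad_hom_def by blast
  have circ: "\<pi> (m + n - 1) (sh_circ ?F m n B f g) = sh_circ (forget P) m n B (\<pi> m f) (\<pi> n g)"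
    if "m \<ge> 1" "n \<ge> 1" "shuffle_index m n B" "f \<in> sh_component ?F m" "g \<in> sh_component ?F n" for m n B f g
    using hom that unfolding shuffle_operad_hom_def by blast
  have zero_mem: "0 \<in> sh_component ?F n" for n by (simp add: comp)
  have zero: "\<pi> n 0 = 0" if "n \<ge> 1" for n using add[OF that zero_mem zero_mem] by simp
  have circ_zero: "sh_circ ?F m n B 0 g = 0" "sh_circ ?F m n B g 0 = 0" for m n B g
    by (simp_all add: free_shuffle_operad_def)
  \<comment> \<open>A composite with 0 in \<open>forget P\<close> is the image of a composite with 0
    in the free operad, which is an empty sum.\<close>
  have left: "\<pi> (m + n - 1) (sh_circ ?F m n B f g) = 0"
    if mn: "m \<ge> 1" "n \<ge> 1" and B: "shuffle_index m n B"
      and f: "f \<in> sh_component ?F m" "\<pi> m f = 0" and g: "g \<in> sh_component ?F n" for m n B f g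
    using circ[OF mn B f(1) g] circ[OF mn B zero_mem g] f(2) mn zero[of m] zero[of "m + n - 1"]
    by (simp add: circ_zero)
  have right: "\<pi> (m + n - 1) (sh_circ ?F m n B g f) = 0"
    if mn: "m \<ge> 1" "n \<ge> 1" and B: "shuffle_index m n B"
      and f: "f \<in> sh_component ?F n" "\<pi> n f = 0" and g: "g \<in> sh_component ?F m" for m n B f g
    using circ[OF mn B g f(1)] circ[OF mn B g zero_mem] f(2) mn zero[of n] zero[of "m + n - 1"]
    by (simp add: circ_zero)
  show ?thesis
  proof
    show "admissible_order \<Upsilon> r" by (rule order)
  next
    fix n and f :: "'x ptree \<Rightarrow>\<^sub>0 'k" assume "f \<in> kernel ?F \<pi> n"
    then show "Poly_Mapping.keys f \<subseteq> shuffle_monomials \<Upsilon> n" by (simp add: kernel_def comp)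
  next
    fix m n B t and f h :: "'x ptree \<Rightarrow>\<^sub>0 'k"
    assume *: "m \<ge> 1" "n \<ge> 1" "shuffle_index m n B" "f \<in> kernel ?F \<pi> m" "t \<in> shuffle_monomials \<Upsilon> n"
      "h = sh_circ ?F m n B f (Poly_Mapping.single t 1)" "Poly_Mapping.keys h \<subseteq> shuffle_monomials \<Upsilon> (m + n - 1)"
    have "\<pi> (m + n - 1) h = 0"
      unfolding *(6) by (rule left[OF *(1-3)]) (use *(4,5) in \<open>auto simp: kernel_def comp\<close>)
    then show "h \<in> kernel ?F \<pi> (m + n - 1)" using *(7) by (simp add: kernel_def comp)
  next
    fix m n B t and f h :: "'x ptree \<Rightarrow>\<^sub>0 'k"
    assume *: "m \<ge> 1" "n \<ge> 1" "shuffle_index m n B" "t \<in> shuffle_monomials \<Upsilon> m" "f \<in> kernel ?F \<pi> n"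
      "h = sh_circ ?F m n B (Poly_Mapping.single t 1) f" "Poly_Mapping.keys h \<subseteq> shuffle_monomials \<Upsilon> (m + n - 1)"
    have "\<pi> (m + n - 1) h = 0"
      unfolding *(6) by (rule right[OF *(1-3)]) (use *(4,5) in \<open>auto simp: kernel_def comp\<close>)
    then show "h \<in> kernel ?F \<pi> (m + n - 1)" using *(7) by (simp add: kernel_def comp)
  qed
qed

theorem corollary3p3p4:
  fixes P :: "('k::field_char_0, 'a::ab_group_add) symmetric_operad"
    and \<Upsilon> :: "nat \<Rightarrow> 'x::ab_group_add set"
  assumes "symmetric_operad P"
    and "\<And>n. n \<ge> 1 \<Longrightarrow> \<exists>B. finite B \<and> module.span (scal P) B = component P n"
    and "symmetric_regular_finite_groebner P \<Upsilon>"
  shows "\<exists>Q :: rat poly poly. Q \<noteq> 0 \<and> poly (map_poly fps_of_poly Q) (exp_gen_series P) = 0"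
proof -
  let ?F = "free_shuffle_operad \<Upsilon> :: ('k, 'x ptree \<Rightarrow>\<^sub>0 'k) shuffle_operad"
  obtain X :: "('k, 'x) symmetric_collection" and \<pi> r G where
    pres: "shuffle_presentation P X \<Upsilon> \<pi>" and order: "admissible_order \<Upsilon> r"
    and gb: "groebner_basis r (kernel ?F \<pi>) G" and red: "reduced r G"
    and fin_G: "finite (\<Union>n\<in>{1..}. G n)" and reg: "symmetric_regular \<Upsilon> (leading_monomials r G)"
    and fin_ops: "finite (SIGMA n:{1..}. \<Upsilon> n)"
    using assms(3) unfolding symmetric_regular_finite_groebner_def by (elim conjE exE) (rule that)
  define M where "M = leading_monomials r G"
  have hom: "shuffle_operad_hom ?F (forget P) \<pi>"
    and surj: "\<And>n. n \<ge> 1 \<Longrightarrow> \<pi> n ` sh_component ?F n = component P n"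
    using pres unfolding shuffle_presentation_def by simp_all
  interpret I: shuffle_operad_ideal \<Upsilon> r "kernel ?F \<pi>"
    by (rule shuffle_operad_ideal_kernel[OF order hom])
  have G: "g \<in> kernel ?F \<pi> k" "g \<noteq> 0" "I.leading k (leading_monomial (r k) g)"
    "leading_monomial (r k) g \<in> Poly_Mapping.keys g"
    "leading_monomial (r k) g \<in> shuffle_monomials \<Upsilon> k" if "k \<ge> 1" "g \<in> G k" for k g
  proof -
    show mem: "g \<in> kernel ?F \<pi> k" using gb that unfolding groebner_basis_def by blast
    \<comment> \<open>Leading coefficient 1 excludes \<open>g = 0\<close>, for which no leading
      monomial exists.\<close>
    have "Poly_Mapping.lookup g (leading_monomial (r k) g) = 1" using red that unfolding reduced_def by blast
    then show nz: "g \<noteq> 0" by auto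
    note lead = leading_monomial_greatest[OF I.well_order[OF that(1)] I.component[OF that(1) mem] nz]
    then show "I.leading k (leading_monomial (r k) g)" using mem unfolding I.leading_def by blast
    show "leading_monomial (r k) g \<in> Poly_Mapping.keys g" using lead by blast
    then show "leading_monomial (r k) g \<in> shuffle_monomials \<Upsilon> k" using I.component[OF that(1) mem] by blast
  qed
  have M: "\<exists>k\<ge>1. \<exists>g\<in>G k. w = leading_monomial (r k) g" if "w \<in> M" for w
    using that unfolding M_def leading_monomials_def by auto
  \<comment> \<open>\<open>leading_monomial (r k) g\<close> depends on \<open>k\<close> as well, but
    it is always one of the finitely many keys of \<open>g\<close>.\<close>
  have "M \<subseteq> (\<Union>g\<in>(\<Union>n\<in>{1..}. G n). Poly_Mapping.keys g)"
  proof
    fix w assume "w \<in> M"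
    then obtain k g where "k \<ge> 1" "g \<in> G k" "w = leading_monomial (r k) g" using M by blast
    then show "w \<in> (\<Union>g\<in>(\<Union>n\<in>{1..}. G n). Poly_Mapping.keys g)"
      using G(4)[of k g] by (intro UN_I[of g] UN_I[of k]) simp_all
  qed
  then have fin_M: "finite M" by (rule finite_subset) (intro finite_UN_I fin_G finite_keys)
  have M_sub: "M \<subseteq> (\<Union>n\<in>{1..}. shuffle_monomials \<Upsilon> n)"
  proof
    fix w assume "w \<in> M"
    then obtain k g where "k \<ge> 1" "g \<in> G k" "w = leading_monomial (r k) g" using M by blast
    then show "w \<in> (\<Union>n\<in>{1..}. shuffle_monomials \<Upsilon> n)"
      using G(5)[of k g] by (intro UN_I[of k]) simp_all
  qed
  interpret T: tree_patterns \<Upsilon> M by unfold_locales (fact fin_ops fin_M)+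
  note divides = T.not_accepted_iff_divides[OF M_sub reg[folded M_def]]
  interpret P: symmetric_operad P by (rule assms(1))
  let ?N = "\<lambda>n. {t \<in> shuffle_monomials \<Upsilon> n. T.accepted t}"
  have N: "finite (?N n) \<and> vector_space.dim (scal P) (component P n) = card (?N n)" if n: "n \<ge> 1" for n
  proof -
    obtain B where B: "finite B" "module.span (scal P) B = component P n" using assms(2)[OF n] by blast
    have comp: "sh_component ?F n = {f. Poly_Mapping.keys f \<subseteq> shuffle_monomials \<Upsilon> n}"
      by (simp add: free_shuffle_operad_def)
    have ker: "f \<in> kernel ?F \<pi> n \<longleftrightarrow> Poly_Mapping.keys f \<subseteq> shuffle_monomials \<Upsilon> n \<and> \<pi> n f = 0" for f
      by (simp add: kernel_def comp)
    have lin: "\<pi> n (f + g) = \<pi> n f + \<pi> n g" "\<pi> n (sh_scal ?F c f) = sh_scal (forget P) c (\<pi> n f)"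
      if "f \<in> sh_component ?F n" "g \<in> sh_component ?F n" for f g c
      using hom n that unfolding shuffle_operad_hom_def by blast+
    show ?thesis
    \<comment> \<open>The Groebner property makes leading monomials of kernel elements non-normal;
      \<open>leading_divides\<close> realizes every non-normal monomial as such a leading
      monomial.\<close>
    proof (rule dim_eq_card_normal[OF P.vector_space I.well_order[OF n], of "\<pi> n" "component P n" B])
      fix f g :: "'x ptree \<Rightarrow>\<^sub>0 'k" and c
      assume f: "Poly_Mapping.keys f \<subseteq> shuffle_monomials \<Upsilon> n"
      show "\<pi> n (f + g) = \<pi> n f + \<pi> n g" if "Poly_Mapping.keys g \<subseteq> shuffle_monomials \<Upsilon> n"
        using lin(1) f that by (simp add: comp)
      show "\<pi> n (Poly_Mapping.map ((*) c) f) = scal P c (\<pi> n f)"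
        using lin(2)[of f f c] f by (simp add: comp) (simp add: free_shuffle_operad_def forget_def)
      assume "\<pi> n f = 0" "f \<noteq> 0"
      then have f_ker: "f \<in> kernel ?F \<pi> n" using f ker by blast
      then obtain k g where k: "k \<ge> 1" "g \<in> G k"
        "divides (leading_monomial (r k) g) (leading_monomial (r n) f)"
        using gb n \<open>f \<noteq> 0\<close> unfolding groebner_basis_def by blast
      have "leading_monomial (r k) g \<in> M" using k(1,2) unfolding M_def leading_monomials_def by auto
      moreover have "leading_monomial (r n) f \<in> shuffle_monomials \<Upsilon> n"
        using leading_monomial_greatest[OF I.well_order[OF n] f \<open>f \<noteq> 0\<close>] f by blast
      ultimately have "\<not> T.accepted (leading_monomial (r n) f)" using divides k(3) by blast
      then show "leading_monomial (r n) f \<notin> ?N n" by blast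
    next
      fix v assume "v \<in> shuffle_monomials \<Upsilon> n - ?N n"
      then have v: "v \<in> shuffle_monomials \<Upsilon> n" "\<not> T.accepted v" by auto
      then obtain w where w: "w \<in> M" "divides w v" using divides by blast
      obtain k g where k: "k \<ge> 1" "g \<in> G k" "w = leading_monomial (r k) g"
        using M[OF w(1)] by blast
      then have "I.leading k w" using G(3) by blast
      then have "I.leading n v" by (rule I.leading_divides[OF _ k(1) w(2) v(1)])
      then show "\<exists>f. Poly_Mapping.keys f \<subseteq> shuffle_monomials \<Upsilon> n \<and> \<pi> n f = 0 \<and>
          v \<in> Poly_Mapping.keys f \<and> (\<forall>s\<in>Poly_Mapping.keys f. (s, v) \<in> r n)"
        unfolding I.leading_def using ker by blast
    next
      show "\<pi> n ` {f. Poly_Mapping.keys f \<subseteq> shuffle_monomials \<Upsilon> n} = component P n"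
        using surj[OF n] by (simp add: comp)
    qed (use B in auto)
  qed
  \<comment> \<open>The dimension count has also shown that there are finitely many accepted
    monomials in each positive arity.\<close>
  interpret A: finite_tree_automaton \<Upsilon> "Pow T.parts" "T.parts \<inter> {SLeaf}" T.root_parts
    "\<lambda>q. q \<inter> tree_skeleton ` M = {}"
    by unfold_locales (use N in blast)
  \<comment> \<open>This matches the coefficient in degree 0, which \<open>exp_gen_series\<close>
    sets to 0.\<close>
  have "shuffle_monomials \<Upsilon> 0 = {}"
    using leaves_nonempty by (fastforce simp: shuffle_monomials_def)
  then have "exp_gen_series P = Abs_fps (\<lambda>n. of_nat (card (?N n)) / fact n)"
    unfolding exp_gen_series_def using N by (intro arg_cong[of _ _ Abs_fps] ext) simp
  then show ?thesis using A.algebraic_accepted by simp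
qed

end
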